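(* Let $p\geq 3$ be a prime, let $\lambda\in\mathbb{C}_p$ be not a root of unity, and suppose $1/p<|1-\lambda|<1$. Put $P_{\lambda}(x):=\lambda x+x^2\in\mathbb{C}_p[x]$. Then the linearization disk $\Delta_{P_{\lambda}}$ of $P_\lambda$ about $0$ is the open disk $D_{r(P_\lambda)}(0)$, where $$r(P_{\lambda})=|1-\lambda|^{-1/p}\,\tilde{r}(\lambda).$$
   Context: $\mathbb{C}_p$ is the completion of an algebraic closure of $\mathbb{Q}_p$, with absolute value normalized by $|p|=1/p$. $D_r(0)=\{x\in\mathbb{C}_p:|x|<r\}$. The linearization disk $\Delta_f$ of a power series $f(x)=\lambda x+\cdots$ with coefficients of absolute value at most $1$, $|\lambda|=1$, $\lambda$ not a root of unity, is the maximal disk about the origin on which $f$ is analytically conjugate to $T_\lambda:x\mapsto\lambda x$ (via the power series $H_f$ with $H_f(0)=0$, $H_f'(0)=1$, $H_f\circ f=\lambda H_f$), and $r(f)$ denotes its exact radius. Definition of $\tilde r(\lambda)$. Put $R(0):=0$ and $R(j):=p^{-\frac{1}{p^{j-1}(p-1)}}$ for integers $j\ge 1$. Let $\Gamma_r$ be the group of roots of unity in $\mathbb{C}_p$ of order a power of $p$ (including $1$). Let $m=\min\{n\ge 1:|1-\lambda^n|<1\}$ (so $m=1$ when $|1-\lambda|<1$), let $s\ge 0$ be the integer with $R(s)\le|1-\lambda^m|<R(s+1)$, let $\gamma_0\in\Gamma_r$ be an element minimizing $|\gamma_0-\lambda^m|$ over $\Gamma_r$, and let $t\ge 0$ be the integer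 with $R(t)\le|\gamma_0-\lambda^m|<R(t+1)$. Then $$\tilde r(\lambda):=R(s+1)^{\frac1m}\,p^{-\frac{s-t}{mp^s}}\,|1-\lambda^m|^{s\frac{p-1}{mp}}\,|\gamma_0-\lambda^m|^{\frac{1}{mp^{s-t}}}.$$ *)

theory Defs
  imports "HOL-Analysis.Elementary_Metric_Spaces" "HOL-Computational_Algebra.Computational_Algebra"
begin

section \<open>The field of complex p-adic numbers\<close>

text \<open>
  The absolute value is the distance to 0; \<open>complete_space\<close> is completeness of the metric.  Real normed
  classes are not available, as the complex p-adic numbers are not a normed real vector space, and
  the constant \<open>norm\<close> cannot be used below these classes.
\<close>

definition absv :: "'a::{zero, metric_space} \<Rightarrow> real" where
  "absv x = dist x 0"

definition Qp_part :: "'a::{field_char_0, metric_space} set" where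
  "Qp_part = closure (range of_rat)"

definition Qp_algebraic :: "'a::{field_char_0, metric_space} set" where
  "Qp_algebraic = {x. \<exists>q. q \<noteq> 0 \<and> (\<forall>i. poly.coeff q i \<in> Qp_part) \<and> poly q x = 0}"

text \<open>
  The predicate says that the type is a completion of an algebraic closure of \<open>Q_p\<close>, which determines
  it up to isometric isomorphism: since the type is complete, the closure of the rationals is a copy
  of \<open>Q_p\<close>; the elements algebraic over it form an algebraically closed set, hence an algebraic
  closure of \<open>Q_p\<close>; and these are dense.  Nonnegativity and definiteness of
  the absolute value come from the metric.
\<close>

definition padic_complex_numbers ::
    "nat \<Rightarrow> 'a::{field_char_0, complete_space} itself \<Rightarrow> bool" where
  "padic_complex_numbers p (ty :: 'a itself) \<longleftrightarrow>
     prime p \<and>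
     (\<forall>x y :: 'a. dist x y = absv (x - y)) \<and>
     (\<forall>x y :: 'a. absv (x * y) = absv x * absv y) \<and>
     (\<forall>x y :: 'a. absv (x + y) \<le> max (absv x) (absv y)) \<and>
     absv (of_nat p :: 'a) = 1 / real p \<and>
     (\<forall>q :: 'a poly. degree q > 0 \<and> (\<forall>i. poly.coeff q i \<in> Qp_algebraic) \<longrightarrow>
        (\<exists>x\<in>Qp_algebraic. poly q x = 0)) \<and>
     closure (Qp_algebraic :: 'a set) = UNIV"


section \<open>Linearization disks\<close>

definition series_converges :: "'a::{field, metric_space} fps \<Rightarrow> 'a \<Rightarrow> bool" where
  "series_converges f x \<longleftrightarrow> summable (\<lambda>n. fps_nth f n * x ^ n)"

definition series_eval :: "'a::{field, metric_space} fps \<Rightarrow> 'a \<Rightarrow> 'a" where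
  "series_eval f x = (\<Sum>n. fps_nth f n * x ^ n)"

definition multiplier :: "'a::zero fps \<Rightarrow> 'a" where
  "multiplier f = fps_nth f 1"

text \<open>Uniquely determined if the constant term of \<open>f\<close> is 0 and its multiplier is neither 0
  nor a root of unity.\<close>

definition conjugacy_series :: "'a::field fps \<Rightarrow> 'a fps" where
  "conjugacy_series f = (THE H. fps_nth H 0 = 0 \<and> fps_nth H 1 = 1 \<and>
      fps_compose H f = fps_const (multiplier f) * H)"

text \<open>
  Analytic conjugacy of \<open>f\<close> on \<open>U\<close> to multiplication by the multiplier on the image \<open>H(U)\<close>.  The last
  conjunct says that \<open>H\<close> has an analytic inverse on \<open>H(U)\<close>, so it includes injectivity of \<open>H\<close> on \<open>U\<close>;
  in general \<open>H\<close> may converge, and satisfy the functional equation, on a larger disk.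
\<close>

definition analytically_conjugate_on :: "'a::{field, metric_space} fps \<Rightarrow> 'a set \<Rightarrow> bool" where
  "analytically_conjugate_on f U \<longleftrightarrow>
     (let H = conjugacy_series f in
       (\<forall>x\<in>U. series_converges f x \<and> series_eval f x \<in> U) \<and>
       (\<forall>x\<in>U. series_converges H x) \<and>
       (\<forall>x\<in>U. series_eval H (series_eval f x) = multiplier f * series_eval H x) \<and>
       (\<exists>G. \<forall>x\<in>U. series_converges G (series_eval H x) \<and>
                   series_eval G (series_eval H x) = x))"

definition is_disk :: "'a::{zero, metric_space} set \<Rightarrow> bool" where
  "is_disk D \<longleftrightarrow> (\<exists>r>0. D = ball 0 r \<or> D = cball 0 r)"

definition is_linearization_disk :: "'a::{field, metric_space} fps \<Rightarrow> 'a set \<Rightarrow> bool" where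
  "is_linearization_disk f D \<longleftrightarrow> is_disk D \<and> analytically_conjugate_on f D \<and>
     (\<forall>D'. is_disk D' \<and> analytically_conjugate_on f D' \<longrightarrow> D' \<subseteq> D)"

definition linearization_disk :: "'a::{field, metric_space} fps \<Rightarrow> 'a set" where
  "linearization_disk f = (THE D. is_linearization_disk f D)"

text \<open>As the absolute values are dense in the nonnegative reals, the radius of a disk about 0,
  open or closed, is the supremum of the absolute values of its points.\<close>

definition linearization_radius :: "'a::{field, metric_space} fps \<Rightarrow> real" where
  "linearization_radius f = (SUP x\<in>linearization_disk f. absv x)"


definition P_quadratic :: "'a::comm_ring_1 \<Rightarrow> 'a fps" where
  "P_quadratic l = fps_of_poly [:0, l, 1:]"


section \<open>The radius formula\<close>

definition unity_radius :: "nat \<Rightarrow> nat \<Rightarrow> real" where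
  "unity_radius p j =
     (if j = 0 then 0 else real p powr (- (1 / (real p ^ (j - 1) * (real p - 1)))))"

definition radius_index :: "nat \<Rightarrow> real \<Rightarrow> nat" where
  "radius_index p x = (THE s. unity_radius p s \<le> x \<and> x < unity_radius p (s + 1))"

definition p_power_unity_roots :: "nat \<Rightarrow> 'a::field set" where
  "p_power_unity_roots p = {\<gamma>. \<exists>k. \<gamma> ^ (p ^ k) = 1}"

definition r_tilde :: "nat \<Rightarrow> 'a::{field, metric_space} \<Rightarrow> real" where
  "r_tilde p l =
     (let m = (LEAST n. n \<ge> 1 \<and> absv (1 - l ^ n) < 1);
          s = radius_index p (absv (1 - l ^ m));
          \<gamma>0 = arg_min_on (\<lambda>\<gamma>. absv (\<gamma> - l ^ m)) (p_power_unity_roots p);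
          t = radius_index p (absv (\<gamma>0 - l ^ m))
      in unity_radius p (s + 1) powr (1 / real m)
         * real p powr (- ((real s - real t) / (real m * real p ^ s)))
         * absv (1 - l ^ m) powr (real s * ((real p - 1) / (real m * real p)))
         * absv (\<gamma>0 - l ^ m) powr (1 / (real m * real p powr (real s - real t))))"

end

theory Submission
  imports Defs
begin

text \<open>
  The coefficients \<open>b k\<close> of the conjugacy satisfy the linear recursion obtained by comparing
  coefficients in the functional equation.  Since \<open>1 / p < \<bar>1 - \<lambda>\<bar> < 1\<close>, one term of it is strictly
  dominant, which gives \<open>\<bar>b (n + 1)\<bar> = c 1 * \<dots> * c n\<close> with \<open>c j\<close> equal to \<open>1 / \<bar>1 - \<lambda>\<bar>\<close> or
  \<open>\<bar>1 - \<lambda>\<bar> / \<bar>1 - \<lambda>^j\<bar>\<close>, according to whether \<open>p\<close> divides \<open>j\<close>.  The logarithm of \<open>c j\<close> is a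
  nondecreasing function of the \<open>p\<close>-adic valuation of \<open>j\<close>, so its averages never exceed their
  limit \<open>- ln r\<close>; hence \<open>\<bar>b (n + 1)\<bar> * r^n \<le> 1\<close>, and for \<open>n\<close> a large power of \<open>p\<close> the left-hand side is
  a positive constant.  The bound makes the conjugacy and its formal inverse converge on the open
  disk of radius \<open>r\<close> and preserve it, and the constant excludes convergence outside.  The limit is
  computed from \<open>\<bar>1 - \<lambda>^(p^i)\<bar>\<close>, which is read off the factorization of \<open>X^(p^i) - 1\<close>.
\<close>

section \<open>Power series over complete ultrametric fields\<close>

locale complete_ultrametric_field =
  fixes ty :: "'a::{field_char_0, complete_space} itself"
  assumes dist_absv: "\<And>x y :: 'a. dist x y = absv (x - y)"
    and absv_mult: "\<And>x y :: 'a. absv (x * y) = absv x * absv y"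
    and absv_add_le: "\<And>x y :: 'a. absv (x + y) \<le> max (absv x) (absv y)"
begin

section \<open>Elementary properties of the ultrametric absolute value\<close>

lemma absv_nonneg [simp]: "absv (x :: 'a) \<ge> 0"
  by (simp add: absv_def)

lemma absv_0 [simp]: "absv (0 :: 'a) = 0"
  by (simp add: absv_def)

lemma absv_eq_0_iff [simp]: "absv (x :: 'a) = 0 \<longleftrightarrow> x = 0"
  by (simp add: absv_def)

lemma absv_pos_iff [simp]: "0 < absv (x :: 'a) \<longleftrightarrow> x \<noteq> 0"
  by (simp add: absv_def)

lemma absv_1 [simp]: "absv (1 :: 'a) = 1"
proof -
  have "absv (1 :: 'a) * absv (1 :: 'a) = absv (1 :: 'a)"
    using absv_mult[of 1 1] by simp
  then show ?thesis by simp
qed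

lemma absv_minus [simp]: "absv (- x :: 'a) = absv x"
proof -
  have "absv (- 1 :: 'a) ^ 2 = 1"
    using absv_mult[of "- 1" "- 1"] by (simp add: power2_eq_square)
  then have "absv (- 1 :: 'a) = 1"
    using absv_nonneg[of "- 1"] by (simp add: power2_eq_1_iff)
  then show ?thesis
    using absv_mult[of "- 1" x] by simp
qed

lemma absv_minus_commute: "absv (x - y :: 'a) = absv (y - x)"
  using absv_minus[of "x - y"] by simp

lemma absv_diff_le: "absv (x - y :: 'a) \<le> max (absv x) (absv y)"
  using absv_add_le[of x "- y"] by simp

lemma absv_power: "absv (x ^ n :: 'a) = absv x ^ n"
  by (induction n) (simp_all add: absv_mult)

lemma absv_inverse: "absv (inverse x :: 'a) = inverse (absv x)"
proof (cases "x = 0")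
  case False
  then have "absv x * absv (inverse x) = 1"
    using absv_mult[of x "inverse x"] by simp
  then show ?thesis by (simp add: inverse_unique)
qed simp

lemma absv_divide: "absv (x / y :: 'a) = absv x / absv y"
  by (simp add: divide_inverse absv_mult absv_inverse)

lemma absv_prod: "absv (\<Prod>i\<in>A. f i :: 'a) = (\<Prod>i\<in>A. absv (f i))"
  by (induction A rule: infinite_finite_induct) (simp_all add: absv_mult)

lemma absv_sum_le:
  assumes "\<And>i. i \<in> A \<Longrightarrow> absv (f i :: 'a) \<le> C" and "0 \<le> C"
  shows "absv (sum f A) \<le> C"
  using assms
proof (induction A rule: infinite_finite_induct)
  case (insert x F)
  have "absv (f x + sum f F) \<le> max (absv (f x)) (absv (sum f F))"
    by (rule absv_add_le)
  also have "\<dots> \<le> C"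
    using insert by auto
  finally show ?case
    using insert by simp
qed simp_all

text \<open>Since x = (x + y) - y, a sum smaller than x would force |x| \<le> |y|. Through this
  principle a strictly dominant summand gives an exact absolute value.\<close>

lemma absv_add_eq_left:
  assumes "absv (y :: 'a) < absv x"
  shows "absv (x + y) = absv x"
proof (rule antisym)
  show "absv (x + y) \<le> absv x"
    using absv_add_le[of x y] assms by simp
  show "absv x \<le> absv (x + y)"
    using absv_diff_le[of "x + y" y] assms by simp
qed

lemma absv_of_nat_le_1: "absv (of_nat n :: 'a) \<le> 1"
proof (induction n)
  case (Suc n)
  then show ?case
    using absv_add_le[of 1 "of_nat n"] by simp
qed simp

section \<open>Convergence of infinite sums\<close>

lemma sums_iff_absv:
  "u sums (S :: 'a) \<longleftrightarrow> (\<lambda>n. absv ((\<Sum>i<n. u i) - S)) \<longlonglongrightarrow> 0"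
  unfolding sums_def by (subst tendsto_dist_iff) (simp add: dist_absv)

lemma sums_if_remainder_bound:
  assumes "\<And>N. absv (S - (\<Sum>n<N. u n) :: 'a) \<le> C * q ^ N" and "0 \<le> q" "q < 1"
  shows "u sums S"
  unfolding sums_iff_absv
proof (rule tendsto_sandwich[OF _ _ tendsto_const])
  show "\<forall>\<^sub>F n in sequentially. absv ((\<Sum>i<n. u i) - S) \<le> C * q ^ n"
    using assms(1) by (simp add: absv_minus_commute)
  show "(\<lambda>n. C * q ^ n) \<longlonglongrightarrow> 0"
    using assms(2,3) by (intro tendsto_mult_right_zero LIMSEQ_power_zero) simp
qed simp

lemma absv_diff_partial_sums_le:
  assumes "\<And>n. absv (u n :: 'a) \<le> C * q ^ n" and "0 \<le> C" "0 \<le> q" "q < 1" and "N \<le> M"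
  shows "absv ((\<Sum>n<M. u n) - (\<Sum>n<N. u n)) \<le> C * q ^ N"
proof -
  have "(\<Sum>n<M. u n) - (\<Sum>n<N. u n) = (\<Sum>n\<in>{N..<M}. u n)"
    using \<open>N \<le> M\<close> by (metis lessThan_atLeast0 sum_diff_nat_ivl zero_le)
  moreover have "absv (\<Sum>n\<in>{N..<M}. u n) \<le> C * q ^ N"
  proof (rule absv_sum_le)
    fix n assume "n \<in> {N..<M}"
    then have "q ^ n \<le> q ^ N"
      using assms by (intro power_decreasing) auto
    then show "absv (u n) \<le> C * q ^ N"
      using assms(1)[of n] \<open>0 \<le> C\<close> by (meson mult_left_mono order_trans)
  qed (use assms in auto)
  ultimately show ?thesis by simp
qed

text \<open>A block of consecutive terms is no larger than the bound on its first term, so the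
  partial sums are Cauchy. The block bound passes to the limit with the same constant
  \<open>C\<close>, without a factor 1 / (1 - q).\<close>

lemma summable_if_geometric_bound:
  assumes bound: "\<And>n. absv (u n :: 'a) \<le> C * q ^ n" and C: "0 \<le> C" and q: "0 \<le> q" "q < 1"
  shows "u sums suminf u" and "absv (suminf u - (\<Sum>n<N. u n)) \<le> C * q ^ N"
proof -
  let ?s = "\<lambda>N. \<Sum>n<N. u n"
  have lim0: "(\<lambda>n. C * q ^ n) \<longlonglongrightarrow> 0"
    using q by (intro tendsto_mult_right_zero LIMSEQ_power_zero) simp
  have close: "dist (?s M) (?s N) \<le> C * q ^ N" if "N \<le> M" for M N
    using absv_diff_partial_sums_le[OF bound C q that] by (simp add: dist_absv)
  have "Cauchy ?s"
  proof (rule metric_CauchyI)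
    fix e :: real assume "e > 0"
    then obtain K where K: "\<And>n. n \<ge> K \<Longrightarrow> C * q ^ n < e"
      using order_tendstoD(2)[OF lim0, of e] by (auto simp: eventually_sequentially)
    have "dist (?s m) (?s n) < e" if "m \<ge> K" "n \<ge> K" for m n
      using close[of m n] close[of n m] K[OF that(1)] K[OF that(2)]
      by (cases m n rule: linorder_le_cases) (auto simp: dist_commute)
    then show "\<exists>K. \<forall>m\<ge>K. \<forall>n\<ge>K. dist (?s m) (?s n) < e" by blast
  qed
  then obtain S where S: "?s \<longlonglongrightarrow> S"
    using Cauchy_convergent convergent_def by blast
  then have sums: "u sums S"
    by (simp add: sums_def)
  then have eq: "suminf u = S"
    by (rule sums_unique[symmetric])
  show "u sums suminf u"
    using sums eq by simp
  have "dist S (?s N) \<le> C * q ^ N"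
  proof (rule tendsto_upperbound)
    show "(\<lambda>M. dist (?s M) (?s N)) \<longlonglongrightarrow> dist S (?s N)"
      using S by (intro tendsto_dist tendsto_const)
    show "\<forall>\<^sub>F M in sequentially. dist (?s M) (?s N) \<le> C * q ^ N"
      using eventually_ge_at_top[of N] by eventually_elim (rule close)
  qed simp
  then show "absv (suminf u - ?s N) \<le> C * q ^ N"
    using eq by (simp add: dist_absv)
qed

lemma summable_imp_absv_tendsto_0:
  assumes "summable (u :: nat \<Rightarrow> 'a)"
  shows "(\<lambda>n. absv (u n)) \<longlonglongrightarrow> 0"
proof -
  obtain S where "(\<lambda>n. \<Sum>i<n. u i) \<longlonglongrightarrow> S"
    using assms by (auto simp: summable_def sums_def)
  then have "(\<lambda>n. dist (\<Sum>i<Suc n. u i) (\<Sum>i<n. u i)) \<longlonglongrightarrow> dist S S"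
    by (intro tendsto_dist LIMSEQ_Suc)
  then show ?thesis
    by (simp add: dist_absv)
qed


text \<open>The Gauss norm of \<open>u\<close> at radius \<open>r\<close> is at most
  \<open>C\<close>. With \<open>C = r\<close> and zero constant term, \<open>u\<close> maps the open
  disk of radius \<open>r\<close> into itself.\<close>

definition bounded_series :: "real \<Rightarrow> real \<Rightarrow> 'a fps \<Rightarrow> bool" where
  "bounded_series r C u \<longleftrightarrow> (\<forall>n. absv (fps_nth u n) * r ^ n \<le> C)"

lemma bounded_seriesD: "bounded_series r C u \<Longrightarrow> absv (fps_nth u n) * r ^ n \<le> C"
  by (simp add: bounded_series_def)

lemma bounded_series_nonneg: "bounded_series r C u \<Longrightarrow> 0 \<le> C"
  using bounded_seriesD[of r C u 0] absv_nonneg[of "fps_nth u 0"] by (simp del: absv_nonneg)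

lemma bounded_series_mult:
  assumes u: "bounded_series r C u" and v: "bounded_series r D v" and r: "0 < r"
  shows "bounded_series r (C * D) (u * v)"
  unfolding bounded_series_def
proof
  fix n
  have CD: "0 \<le> C" "0 \<le> D"
    using u v by (auto dest: bounded_series_nonneg)
  have "absv (fps_nth (u * v) n) \<le> C * D / r ^ n"
    unfolding fps_mult_nth
  proof (rule absv_sum_le)
    fix i assume i: "i \<in> {0..n}"
    have "absv (fps_nth u i * fps_nth v (n - i)) * r ^ n
        = (absv (fps_nth u i) * r ^ i) * (absv (fps_nth v (n - i)) * r ^ (n - i))"
      using i by (simp add: absv_mult flip: power_add)
    also have "\<dots> \<le> C * D"
      using CD r by (intro mult_mono bounded_seriesD[OF u] bounded_seriesD[OF v]) auto
    finally show "absv (fps_nth u i * fps_nth v (n - i)) \<le> C * D / r ^ n"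
      using r by (simp add: pos_le_divide_eq)
  qed (use CD r in simp)
  then show "absv (fps_nth (u * v) n) * r ^ n \<le> C * D"
    using r by (simp add: pos_le_divide_eq)
qed

lemma bounded_series_power:
  assumes "bounded_series r C u" and "0 < r"
  shows "bounded_series r (C ^ i) (u ^ i)"
proof (induction i)
  case 0
  then show ?case by (simp add: bounded_series_def)
next
  case (Suc i)
  then show ?case
    using bounded_series_mult[OF assms(1) Suc assms(2)] by simp
qed

section \<open>Evaluation at a point of the open disk of radius \<open>r\<close>\<close>

context
  fixes r :: real and x :: 'a
  assumes x: "absv x < r"
begin

lemma radius_pos: "0 < r"
  using x absv_nonneg[of x] by linarith

lemma ratio: "0 \<le> absv x / r" "absv x / r < 1"
  using x radius_pos by auto

lemma absv_term_le:
  assumes "bounded_series r C u"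
  shows "absv (fps_nth u n * x ^ n) \<le> C * (absv x / r) ^ n"
proof -
  have "absv (fps_nth u n * x ^ n) = absv (fps_nth u n) * r ^ n * (absv x / r) ^ n"
    using radius_pos by (simp add: absv_mult absv_power power_divide)
  also have "\<dots> \<le> C * (absv x / r) ^ n"
    using assms ratio by (intro mult_right_mono bounded_seriesD) auto
  finally show ?thesis .
qed

lemma series_sums:
  assumes "bounded_series r C u"
  shows "(\<lambda>n. fps_nth u n * x ^ n) sums series_eval u x"
  unfolding series_eval_def
  by (rule summable_if_geometric_bound(1)[OF absv_term_le[OF assms] bounded_series_nonneg[OF assms]
        ratio])

lemma series_remainder:
  assumes "bounded_series r C u"
  shows "absv (series_eval u x - (\<Sum>n<N. fps_nth u n * x ^ n)) \<le> C * (absv x / r) ^ N"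
  unfolding series_eval_def
  by (rule summable_if_geometric_bound(2)[OF absv_term_le[OF assms] bounded_series_nonneg[OF assms]
        ratio])

lemma series_convergesI: "bounded_series r C u \<Longrightarrow> series_converges u x"
  using series_sums by (auto simp: series_converges_def summable_def)

lemma absv_series_eval_le: "bounded_series r C u \<Longrightarrow> absv (series_eval u x) \<le> C"
  using series_remainder[of C u 0] by simp

text \<open>Identities between values of series are reduced to this criterion, so that no infinite
  sum has to be rearranged, only truncations compared.\<close>

lemma series_eval_eqI:
  assumes "\<And>N. absv (S - (\<Sum>n<N. fps_nth u n * x ^ n)) \<le> C * (absv x / r) ^ N"
  shows "series_eval u x = S"
  unfolding series_eval_def
  by (rule sums_unique[symmetric]) (rule sums_if_remainder_bound[OF assms ratio])

lemma series_eval_mult: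
  assumes u: "bounded_series r C u" and v: "bounded_series r D v"
  shows "series_eval (u * v) x = series_eval u x * series_eval v x"
proof (rule series_eval_eqI[where C = "C * D"])
  fix N
  let ?q = "absv x / r"
  define U where "U = (\<Sum>n<N. fps_nth u n * x ^ n)"
  define V where "V = (\<Sum>n<N. fps_nth v n * x ^ n)"
  define W where "W = (\<Sum>n<N. fps_nth (u * v) n * x ^ n)"
  define g where "g = (\<lambda>i j. (fps_nth u i * x ^ i) * (fps_nth v j * x ^ j))"
  have CD: "0 \<le> C" "0 \<le> D"
    using u v by (auto dest: bounded_series_nonneg)
  \<comment> \<open>The truncated Cauchy product runs over a triangle of index pairs, the product of
    the truncations over a square. The remaining pairs have i + j \<ge> N, hence small
    terms.\<close>
  have tri: "{(i,j). i + j < N} \<subseteq> {..<N} \<times> {..<N}"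
    by auto
  have W: "W = (\<Sum>(i,j)\<in>{(i,j). i + j < N}. g i j)"
    unfolding W_def sum.triangle_reindex
    by (intro sum.cong refl)
       (auto simp: fps_mult_nth atLeast0AtMost sum_distrib_right g_def power_add[symmetric]
          intro!: sum.cong)
  have UV: "U * V = (\<Sum>(i,j)\<in>{..<N} \<times> {..<N}. g i j)"
    by (simp add: U_def V_def sum_product sum.cartesian_product g_def)
  have "U * V - W = (\<Sum>(i,j)\<in>{..<N} \<times> {..<N} - {(i,j). i + j < N}. g i j)"
    unfolding W UV using tri by (subst sum_diff) auto
  also have "absv \<dots> \<le> C * D * ?q ^ N"
  proof (rule absv_sum_le)
    fix z assume z: "z \<in> {..<N} \<times> {..<N} - {(i,j). i + j < N}"
    obtain i j where ij: "z = (i, j)" "N \<le> i + j"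
      using z by (cases z) auto
    have "absv (g i j) \<le> (C * ?q ^ i) * (D * ?q ^ j)"
      unfolding g_def absv_mult[of "_ * _" "_ * _"]
      using CD ratio by (intro mult_mono absv_term_le u v) auto
    also have "\<dots> = C * D * ?q ^ (i + j)"
      by (simp add: power_add)
    also have "\<dots> \<le> C * D * ?q ^ N"
      using CD ratio ij by (intro mult_left_mono power_decreasing) auto
    finally show "absv (case z of (i, j) \<Rightarrow> g i j) \<le> C * D * ?q ^ N"
      using ij by simp
  qed (use CD ratio in simp)
  finally have 1: "absv (U * V - W) \<le> C * D * ?q ^ N" .
  have "absv (series_eval u x * (series_eval v x - V)) \<le> C * (D * ?q ^ N)"
    unfolding absv_mult V_def using CD
    by (intro mult_mono absv_series_eval_le[OF u] series_remainder[OF v]) auto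
  then have 2: "absv (series_eval u x * (series_eval v x - V)) \<le> C * D * ?q ^ N"
    by (simp add: mult_ac)
  have "absv V \<le> D"
    unfolding V_def
  proof (rule absv_sum_le)
    fix n
    have "D * ?q ^ n \<le> D"
      using CD ratio by (simp add: mult_left_le power_le_one)
    then show "absv (fps_nth v n * x ^ n) \<le> D"
      using absv_term_le[OF v, of n] by linarith
  qed (rule CD)
  then have "absv ((series_eval u x - U) * V) \<le> (C * ?q ^ N) * D"
    unfolding absv_mult U_def using CD ratio
    by (intro mult_mono series_remainder[OF u]) auto
  then have 3: "absv ((series_eval u x - U) * V) \<le> C * D * ?q ^ N"
    by (simp add: mult_ac)
  have "series_eval u x * series_eval v x - W
      = (U * V - W) + (series_eval u x * (series_eval v x - V) + (series_eval u x - U) * V)"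
    by (simp add: algebra_simps)
  also have "absv \<dots> \<le> C * D * ?q ^ N"
    using 1 2 3 by (intro order_trans[OF absv_add_le] max.boundedI)
  finally show "absv (series_eval u x * series_eval v x - W) \<le> C * D * ?q ^ N" .
qed

lemma series_eval_power:
  assumes "bounded_series r C u"
  shows "series_eval (u ^ i) x = series_eval u x ^ i"
proof (induction i)
  case 0
  have "series_eval (1 :: 'a fps) x = 1"
  proof (rule series_eval_eqI[where C = 1])
    fix N
    have "(\<Sum>n<N. fps_nth 1 n * x ^ n) = (if N = 0 then 0 else 1)"
      by (induction N) auto
    then show "absv (1 - (\<Sum>n<N. fps_nth 1 n * x ^ n)) \<le> 1 * (absv x / r) ^ N"
      using ratio by simp
  qed
  then show ?case by simp
next
  case (Suc i)
  then show ?case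
    using series_eval_mult[OF assms bounded_series_power[OF assms radius_pos, of i]] by simp
qed

lemma series_eval_const_mult:
  assumes "bounded_series r C u"
  shows "series_eval (fps_const c * u) x = c * series_eval u x"
proof (rule series_eval_eqI[where C = "absv c * C"])
  fix N
  have "c * series_eval u x - (\<Sum>n<N. fps_nth (fps_const c * u) n * x ^ n)
      = c * (series_eval u x - (\<Sum>n<N. fps_nth u n * x ^ n))"
    by (simp add: sum_distrib_left algebra_simps)
  then show "absv (c * series_eval u x - (\<Sum>n<N. fps_nth (fps_const c * u) n * x ^ n))
      \<le> absv c * C * (absv x / r) ^ N"
    using series_remainder[OF assms, of N] by (simp add: absv_mult mult.assoc mult_left_mono)
qed

lemma series_eval_X: "series_eval fps_X x = x"
proof (rule series_eval_eqI[where C = r])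
  fix N
  have sum: "(\<Sum>n<N. fps_nth fps_X n * x ^ n) = (if N \<le> 1 then 0 else x)"
    by (induction N) (auto simp: fps_X_def le_Suc_eq)
  consider "N = 0" | "N = Suc 0" | "N > 1" by linarith
  then show "absv (x - (\<Sum>n<N. fps_nth fps_X n * x ^ n)) \<le> r * (absv x / r) ^ N"
    using x radius_pos unfolding sum by cases auto
qed

lemma absv_series_eval_le_absv:
  assumes "bounded_series r r u" and "fps_nth u 0 = 0"
  shows "absv (series_eval u x) \<le> absv x"
  using series_remainder[OF assms(1), of 1] assms(2) radius_pos by simp

text \<open>For y = h(x) the error of truncation splits into the tail of \<open>u\<close> at y and
  the tails of the powers of \<open>h\<close> at x, weighted by the coefficients of
  \<open>u\<close>. Since |y| \<le> |x|, the Gauss bounds give r * (|x| / r)^N for both.\<close>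

lemma series_eval_compose:
  assumes u: "bounded_series r r u" and h: "bounded_series r r h" and h0: "fps_nth h 0 = 0"
  shows "series_eval (u oo h) x = series_eval u (series_eval h x)"
proof (rule series_eval_eqI[where C = r])
  fix N
  define y where "y = series_eval h x"
  let ?q = "absv x / r"
  have y: "absv y \<le> absv x"
    unfolding y_def by (rule absv_series_eval_le_absv[OF h h0])
  have "(\<Sum>n<N. fps_nth (u oo h) n * x ^ n)
      = (\<Sum>n<N. \<Sum>i<N. fps_nth u i * (fps_nth (h ^ i) n * x ^ n))"
  proof (rule sum.cong[OF refl])
    fix n assume n: "n \<in> {..<N}"
    \<comment> \<open>As \<open>h\<close> has no constant term, \<open>h^i\<close> starts in degree
      \<open>i\<close> at least; so the range of \<open>i\<close> can be extended to one that is
      independent of \<open>n\<close>.\<close>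
    have "fps_nth (u oo h) n = (\<Sum>i<N. fps_nth u i * fps_nth (h ^ i) n)"
      unfolding fps_compose_nth
      by (rule sum.mono_neutral_left)
         (use n startsby_zero_power_prefix[OF h0] in auto)
    then show "fps_nth (u oo h) n * x ^ n
        = (\<Sum>i<N. fps_nth u i * (fps_nth (h ^ i) n * x ^ n))"
      by (simp add: sum_distrib_right mult.assoc)
  qed
  also have "\<dots> = (\<Sum>i<N. fps_nth u i * (\<Sum>n<N. fps_nth (h ^ i) n * x ^ n))"
    by (subst sum.swap) (simp add: sum_distrib_left)
  finally have "(\<Sum>i<N. fps_nth u i * y ^ i) - (\<Sum>n<N. fps_nth (u oo h) n * x ^ n)
      = (\<Sum>i<N. fps_nth u i * (y ^ i - (\<Sum>n<N. fps_nth (h ^ i) n * x ^ n)))"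
    by (simp add: sum_subtractf right_diff_distrib)
  also have "absv \<dots> \<le> r * ?q ^ N"
  proof (rule absv_sum_le)
    fix i
    have "absv (y ^ i - (\<Sum>n<N. fps_nth (h ^ i) n * x ^ n)) \<le> r ^ i * ?q ^ N"
      using series_remainder[OF bounded_series_power[OF h radius_pos, of i], of N]
      by (simp add: series_eval_power[OF h] y_def)
    then have "absv (fps_nth u i * (y ^ i - (\<Sum>n<N. fps_nth (h ^ i) n * x ^ n)))
        \<le> absv (fps_nth u i) * (r ^ i * ?q ^ N)"
      by (simp add: absv_mult mult_left_mono)
    also have "\<dots> = (absv (fps_nth u i) * r ^ i) * ?q ^ N"
      by simp
    also have "\<dots> \<le> r * ?q ^ N"
      using ratio by (intro mult_right_mono bounded_seriesD[OF u]) auto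
    finally show "absv (fps_nth u i * (y ^ i - (\<Sum>n<N. fps_nth (h ^ i) n * x ^ n)))
        \<le> r * ?q ^ N" .
  qed (use radius_pos in simp)
  finally have 1: "absv ((\<Sum>i<N. fps_nth u i * y ^ i)
      - (\<Sum>n<N. fps_nth (u oo h) n * x ^ n)) \<le> r * ?q ^ N" .
  \<comment> \<open>The remainder estimate is needed at \<open>y\<close> instead of the fixed point
    \<open>x\<close>, hence in its exported form.\<close>
  have "absv (series_eval u y - (\<Sum>i<N. fps_nth u i * y ^ i)) \<le> r * (absv y / r) ^ N"
    using y x by (intro complete_ultrametric_field.series_remainder u)
      (auto intro: complete_ultrametric_field_axioms)
  also have "\<dots> \<le> r * ?q ^ N"
    using y radius_pos by (intro mult_left_mono power_mono divide_right_mono) auto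
  finally have 2: "absv (series_eval u y - (\<Sum>i<N. fps_nth u i * y ^ i)) \<le> r * ?q ^ N" .
  have "absv ((series_eval u y - (\<Sum>i<N. fps_nth u i * y ^ i))
      + ((\<Sum>i<N. fps_nth u i * y ^ i) - (\<Sum>n<N. fps_nth (u oo h) n * x ^ n))) \<le> r * ?q ^ N"
    using 1 2 by (intro order_trans[OF absv_add_le] max.boundedI)
  then show "absv (series_eval u (series_eval h x) - (\<Sum>n<N. fps_nth (u oo h) n * x ^ n))
      \<le> r * ?q ^ N"
    by (simp add: y_def)
qed

end

text \<open>The coefficient of degree \<open>n\<close> in \<open>g oo h = fps_X\<close> is solved
  for that of \<open>g\<close>. Since \<open>h\<close> starts with X, the top term has factor 1 and
  no division occurs, so induction preserves the bound.\<close>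

lemma bounded_series_compositional_inverse:
  assumes h: "bounded_series r r h" and h0: "fps_nth h 0 = 0" and h1: "fps_nth h 1 = 1"
    and r: "0 < r"
  obtains g where "bounded_series r r g" and "g oo h = fps_X"
proof
  show inv: "fps_inv h oo h = fps_X"
    using h0 h1 by (intro fps_inv) auto
  show "bounded_series r r (fps_inv h)"
    unfolding bounded_series_def
  proof
    fix n
    show "absv (fps_nth (fps_inv h) n) * r ^ n \<le> r"
    proof (induction n rule: less_induct)
      case (less n)
      have "fps_nth fps_X n = (\<Sum>i=0..n. fps_nth (fps_inv h) i * fps_nth (h ^ i) n)"
        by (simp flip: inv add: fps_compose_nth)
      also have "\<dots> = (\<Sum>i<n. fps_nth (fps_inv h) i * fps_nth (h ^ i) n) + fps_nth (fps_inv h) n"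
        using startsby_zero_power_nth_same[OF h0, of n] h1
        by (simp add: atLeast0AtMost flip: lessThan_Suc_atMost)
      finally have eq: "fps_nth (fps_inv h) n
          = fps_nth fps_X n - (\<Sum>i<n. fps_nth (fps_inv h) i * fps_nth (h ^ i) n)"
        by simp
      have X: "absv (fps_nth (fps_X :: 'a fps) n) \<le> r / r ^ n"
        using r by (cases "n = 1") (auto simp: fps_X_def)
      have "absv (\<Sum>i<n. fps_nth (fps_inv h) i * fps_nth (h ^ i) n) \<le> r / r ^ n"
      proof (rule absv_sum_le)
        fix i assume i: "i \<in> {..<n}"
        have "absv (fps_nth (fps_inv h) i * fps_nth (h ^ i) n) * r ^ n
            = absv (fps_nth (fps_inv h) i) * (absv (fps_nth (h ^ i) n) * r ^ n)"
          by (simp add: absv_mult)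
        also have "\<dots> \<le> absv (fps_nth (fps_inv h) i) * r ^ i"
          by (intro mult_left_mono bounded_seriesD[OF bounded_series_power[OF h r]]) auto
        also have "\<dots> \<le> r"
          using less i by simp
        finally show "absv (fps_nth (fps_inv h) i * fps_nth (h ^ i) n) \<le> r / r ^ n"
          using r by (simp add: pos_le_divide_eq)
      qed (use r in simp)
      with X have "absv (fps_nth (fps_inv h) n) \<le> r / r ^ n"
        unfolding eq by (meson absv_diff_le max.bounded_iff order_trans)
      then show ?case
        using r by (simp add: pos_le_divide_eq)
    qed
  qed
qed

end


section \<open>Powers of elements close to 1\<close>

text \<open>The index 0 is excluded since \<open>unity_radius p 0 = 0\<close> is a convention.\<close>

lemma unity_radius_power:
  assumes "p \<ge> 2" "1 \<le> j"
  shows "unity_radius p (Suc j) ^ p = unity_radius p j"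
proof -
  obtain i where j: "j = Suc i"
    using assms by (cases j) auto
  have "unity_radius p (Suc j) ^ p
      = real p powr (real p * (- (1 / (real p ^ j * (real p - 1)))))"
    using assms by (simp add: unity_radius_def powr_powr mult.commute flip: powr_realpow)
  also have "real p * (- (1 / (real p ^ j * (real p - 1)))) = - (1 / (real p ^ i * (real p - 1)))"
    using assms by (simp add: j field_simps)
  finally show ?thesis
    by (simp add: unity_radius_def j)
qed

text \<open>So \<open>unity_radius p 1\<close> is the positive d at which d^p and d / p agree: the
  threshold between the two regimes of the \<open>p\<close>-th power map near 1.\<close>

lemma unity_radius_1_power:
  assumes "p \<ge> 2"
  shows "unity_radius p 1 ^ (p - 1) = 1 / real p"
proof -
  have "unity_radius p 1 ^ (p - 1) = real p powr (real (p - 1) * (- (1 / (real p - 1))))"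
    using assms by (simp add: unity_radius_def powr_powr mult.commute flip: powr_realpow)
  also have "real (p - 1) * (- (1 / (real p - 1))) = -1"
    using assms by (simp add: of_nat_diff field_simps)
  finally show ?thesis
    using assms by (simp add: powr_minus_divide)
qed

lemma unity_radius_pos: "p \<ge> 2 \<Longrightarrow> 1 \<le> j \<Longrightarrow> 0 < unity_radius p j"
  by (simp add: unity_radius_def)

lemma unity_radius_nonneg: "p \<ge> 2 \<Longrightarrow> 0 \<le> unity_radius p j"
  by (simp add: unity_radius_def)

lemma unity_radius_less_1:
  assumes "p \<ge> 2"
  shows "unity_radius p j < 1"
proof -
  have "0 < real p ^ (j - 1) * (real p - 1)"
    using assms by simp
  then have "real p powr (- (1 / (real p ^ (j - 1) * (real p - 1)))) < real p powr 0"
    using assms by (subst powr_less_cancel_iff) auto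
  then show ?thesis
    using assms by (simp add: unity_radius_def)
qed

lemma unity_radius_strict_mono:
  assumes "p \<ge> 2"
  shows "strict_mono (unity_radius p)"
unfolding strict_mono_Suc_iff
proof
  fix j
  show "unity_radius p j < unity_radius p (Suc j)"
  proof (cases "j = 0")
    case True
    then show ?thesis
      using assms unity_radius_pos[of p 1] by (simp add: unity_radius_def)
  next
    case False
    have "unity_radius p (Suc j) ^ p < unity_radius p (Suc j) ^ 1"
      using assms unity_radius_pos[of p "Suc j"] unity_radius_less_1[of p "Suc j"]
      by (intro power_strict_decreasing) auto
    then show ?thesis
      using unity_radius_power[of p j] assms False by simp
  qed
qed

lemma unity_radius_tendsto_1:
  assumes "p \<ge> 2"
  shows "unity_radius p \<longlonglongrightarrow> 1"
proof -
  have "(\<lambda>j. (1 / real p) ^ j * (1 / (real p - 1))) \<longlonglongrightarrow> 0"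
    using assms by (intro tendsto_mult_left_zero LIMSEQ_power_zero) auto
  then have "(\<lambda>j. real p powr (- ((1 / real p) ^ j * (1 / (real p - 1))))) \<longlonglongrightarrow> real p powr (- 0)"
    using assms by (intro tendsto_powr tendsto_const tendsto_minus) auto
  then have "(\<lambda>j. unity_radius p (Suc j)) \<longlonglongrightarrow> 1"
    using assms by (simp add: unity_radius_def power_divide)
  then show ?thesis
    by (rule LIMSEQ_imp_Suc)
qed

lemma radius_index_eqI:
  assumes "p \<ge> 2" "unity_radius p s \<le> x" "x < unity_radius p (Suc s)"
  shows "radius_index p x = s"
  unfolding radius_index_def
proof (rule the_equality)
  show "unity_radius p s \<le> x \<and> x < unity_radius p (s + 1)"
    using assms by simp
next
  fix t assume t: "unity_radius p t \<le> x \<and> x < unity_radius p (t + 1)"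
  have "unity_radius p t < unity_radius p (Suc s)" "unity_radius p s < unity_radius p (Suc t)"
    using t assms by auto
  then have "t < Suc s" "s < Suc t"
    using strict_mono_less[OF unity_radius_strict_mono[OF assms(1)]] by auto
  then show "t = s" by simp
qed

lemma radius_index_bounds:
  assumes "p \<ge> 2" "0 \<le> x" "x < 1"
  shows "unity_radius p (radius_index p x) \<le> x" "x < unity_radius p (Suc (radius_index p x))"
proof -
  define n where "n = (LEAST n. x < unity_radius p n)"
  have "\<exists>n. x < unity_radius p n"
    using order_tendstoD(1)[OF unity_radius_tendsto_1[OF assms(1)] assms(3)]
    by (auto simp: eventually_sequentially)
  then have n: "x < unity_radius p n"
    unfolding n_def by (rule LeastI_ex)
  obtain s where s: "n = Suc s"
    using n assms(2) by (cases n) (auto simp: unity_radius_def)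
  have "unity_radius p s \<le> x"
    using not_less_Least[of s "\<lambda>n. x < unity_radius p n"] s by (simp flip: n_def)
  moreover from this have "radius_index p x = s"
    using n s assms(1) by (intro radius_index_eqI) auto
  ultimately show "unity_radius p (radius_index p x) \<le> x"
      "x < unity_radius p (Suc (radius_index p x))"
    using n s by auto
qed


section \<open>Absolute values of integers and of 1 - x^n for x near 1\<close>

locale padic_complex_field =
  fixes p :: nat and ty :: "'a::{field_char_0, complete_space} itself"
  assumes Cp: "padic_complex_numbers p ty"
begin

sublocale complete_ultrametric_field ty
  using Cp by unfold_locales (auto simp: padic_complex_numbers_def)

lemma prime_p: "prime p"
  using Cp by (simp add: padic_complex_numbers_def)

lemma p_ge_2: "p \<ge> 2"
  by (rule prime_ge_2_nat[OF prime_p])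

lemma p_gt_0: "0 < p"
  using p_ge_2 by simp

lemma absv_p: "absv (of_nat p :: 'a) = 1 / real p"
  using Cp by (simp add: padic_complex_numbers_def)

lemma absv_of_nat_dvd_le:
  assumes "p dvd n"
  shows "absv (of_nat n :: 'a) \<le> 1 / real p"
proof -
  obtain k where "n = p * k"
    using assms by blast
  then show ?thesis
    using absv_of_nat_le_1[of k] p_gt_0 by (simp add: absv_mult absv_p divide_right_mono)
qed

text \<open>By Bezout, 1 is a multiple of \<open>n\<close> minus a multiple of \<open>p\<close>; if
  |n| < 1, both would have absolute value below 1.\<close>

lemma absv_of_nat_coprime:
  assumes "\<not> p dvd n"
  shows "absv (of_nat n :: 'a) = 1"
proof (rule ccontr)
  assume "absv (of_nat n :: 'a) \<noteq> 1"
  then have less: "absv (of_nat n :: 'a) < 1"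
    using absv_of_nat_le_1[of n] by simp
  have "n \<noteq> 0"
    using assms by (intro notI) simp
  moreover have "coprime n p"
    using assms prime_imp_coprime[OF prime_p] by (simp add: coprime_commute)
  ultimately obtain x y where "n * x = p * y + 1"
    using bezout_nat[of n p] by (auto simp: coprime_iff_gcd_eq_1)
  then have "(1 :: 'a) = of_nat n * of_nat x - of_nat p * of_nat y"
    by (simp flip: of_nat_mult)
  moreover have "absv (of_nat n * of_nat x :: 'a) < 1"
    using less absv_of_nat_le_1[of x]
    by (simp add: absv_mult) (metis absv_nonneg mult.commute mult_left_le_one_le order_le_less_trans)
  moreover have "absv (of_nat p * of_nat y :: 'a) < 1"
    using absv_of_nat_dvd_le[of "p * y"] p_ge_2 by (simp add: order_le_less_trans)
  ultimately show False
    using absv_diff_le[of "of_nat n * of_nat x" "of_nat p * of_nat y"] by simp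
qed

lemma absv_eq_1_if_close:
  assumes "absv (1 - x :: 'a) < 1"
  shows "absv x = 1"
  using absv_add_eq_left[of "x - 1" 1] assms by (simp add: absv_minus_commute)

lemma absv_1_minus_power_le:
  assumes x: "absv (1 - x :: 'a) < 1"
  shows "absv (1 - x ^ i) \<le> absv (1 - x)"
proof -
  have "absv (\<Sum>j<i. x ^ j) \<le> 1"
    using absv_eq_1_if_close[OF x] by (intro absv_sum_le) (auto simp: absv_power)
  then have "absv (1 - x) * absv (\<Sum>j<i. x ^ j) \<le> absv (1 - x)"
    by (simp add: mult_left_le)
  then show ?thesis
    by (simp add: one_diff_power_eq absv_mult)
qed

text \<open>The cofactor 1 + x + ... + x^(n-1) of 1 - x differs from \<open>n\<close>, which has
  absolute value 1, by terms 1 - x^j of absolute value below 1.\<close>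

lemma absv_1_minus_power_coprime:
  assumes x: "absv (1 - x :: 'a) < 1" and n: "\<not> p dvd n"
  shows "absv (1 - x ^ n) = absv (1 - x)"
proof -
  have "absv (\<Sum>j<n. (1 - x ^ j)) < 1"
    using x absv_1_minus_power_le[OF x]
    by (intro order_le_less_trans[OF absv_sum_le[where C = "absv (1 - x)"]]) auto
  moreover have "(\<Sum>j<n. x ^ j) = of_nat n - (\<Sum>j<n. (1 - x ^ j))"
    by (simp add: sum_subtractf)
  ultimately have "absv (\<Sum>j<n. x ^ j) = 1"
    using absv_add_eq_left[of "- (\<Sum>j<n. (1 - x ^ j))" "of_nat n"] absv_of_nat_coprime[OF n]
    by simp
  then show ?thesis
    by (simp add: one_diff_power_eq absv_mult)
qed

text \<open>The inner binomial coefficients of (1 + y)^p are divisible by \<open>p\<close>, so the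
  terms of degrees 2 to p - 1 are smaller than p y. Only y^p and p y compete for the size of x^p -
  1.\<close>

lemma absv_power_p_expansion:
  fixes x :: 'a
  assumes x: "absv (1 - x) < 1" "x \<noteq> 1"
  defines "y \<equiv> x - 1"
  shows "absv (x ^ p - 1 - y ^ p - of_nat p * y) < absv (1 - x) / real p"
proof -
  have y: "absv y = absv (1 - x)" "absv y < 1" "0 < absv y"
    using x by (auto simp: y_def absv_minus_commute)
  obtain q where q: "p = Suc (Suc q)"
    using p_ge_2 by (metis add_2_eq_Suc le_Suc_ex)
  have "x ^ p = (y + 1) ^ p"
    by (simp add: y_def)
  also have "\<dots> = (\<Sum>k\<le>p. of_nat (p choose k) * y ^ k)"
    by (simp add: binomial_ring)
  also have "{..p} = insert 0 (insert 1 (insert p {2..<p}))"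
    using p_ge_2 by auto
  also have "(\<Sum>k\<in>insert 0 (insert 1 (insert p {2..<p})). of_nat (p choose k) * y ^ k)
      = 1 + of_nat p * y + y ^ p + (\<Sum>k\<in>{2..<p}. of_nat (p choose k) * y ^ k)"
    using p_ge_2 by simp
  finally have "x ^ p - 1 - y ^ p - of_nat p * y = (\<Sum>k\<in>{2..<p}. of_nat (p choose k) * y ^ k)"
    by simp
  also have "absv \<dots> \<le> absv y ^ 2 / real p"
  proof (rule absv_sum_le)
    fix k assume k: "k \<in> {2..<p}"
    have "p dvd (p choose k)"
    proof -
      have "k * (p choose k) = p * ((p - 1) choose (k - 1))"
        using k by (intro times_binomial_minus1_eq) auto
      then have "p dvd k * (p choose k)"
        by simp
      moreover have "\<not> p dvd k"
        using k by (auto dest: dvd_imp_le)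
      ultimately show ?thesis
        using prime_dvd_mult_iff[OF prime_p] by simp
    qed
    then have "absv (of_nat (p choose k) * y ^ k) \<le> 1 / real p * absv y ^ 2"
      unfolding absv_mult absv_power using k y
      by (intro mult_mono absv_of_nat_dvd_le power_decreasing) auto
    then show "absv (of_nat (p choose k) * y ^ k) \<le> absv y ^ 2 / real p"
      by simp
  qed simp
  also have "\<dots> < absv y / real p"
    using y p_gt_0 by (intro divide_strict_right_mono) (auto simp: power2_eq_square)
  finally show ?thesis
    by (simp add: y)
qed

lemma absv_1_minus_power_p_le:
  assumes "absv (1 - x :: 'a) < 1"
  shows "absv (1 - x ^ p) \<le> max (absv (1 - x) ^ p) (absv (1 - x) / real p)"
proof (cases "x = 1")
  case False
  define y where "y = x - 1"
  have y: "absv y = absv (1 - x)"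
    by (simp add: y_def absv_minus_commute)
  have "x ^ p - 1 = (x ^ p - 1 - y ^ p - of_nat p * y) + (y ^ p + of_nat p * y)"
    by simp
  moreover have "absv (x ^ p - 1 - y ^ p - of_nat p * y) \<le> absv (1 - x) / real p"
    using absv_power_p_expansion[OF assms False] by (simp add: y_def)
  moreover have "absv (y ^ p + of_nat p * y) \<le> max (absv (1 - x) ^ p) (absv (1 - x) / real p)"
    using absv_add_le[of "y ^ p" "of_nat p * y"] by (simp add: absv_mult absv_power absv_p y)
  ultimately have "absv (x ^ p - 1) \<le> max (absv (1 - x) ^ p) (absv (1 - x) / real p)"
    using absv_add_le[of "x ^ p - 1 - y ^ p - of_nat p * y" "y ^ p + of_nat p * y"] by simp
  then show ?thesis
    by (simp add: absv_minus_commute)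
qed (simp add: p_gt_0)

lemma unity_radius_1_less_imp:
  assumes "unity_radius p 1 < d"
  shows "d / real p < d ^ p"
proof -
  have d: "0 < d"
    using assms unity_radius_pos[of p 1] p_ge_2 by simp
  have "1 / real p < d ^ (p - 1)"
    using assms unity_radius_pos[of p 1] p_ge_2
    by (subst unity_radius_1_power[symmetric]) (auto intro!: power_strict_mono)
  then have "d * (1 / real p) < d * d ^ (p - 1)"
    using d by (rule mult_strict_left_mono)
  then show ?thesis
    using p_gt_0 by (simp flip: power_Suc)
qed

lemma less_unity_radius_1_imp:
  assumes "d < unity_radius p 1" "0 < d"
  shows "d ^ p < d / real p"
proof -
  have "d ^ (p - 1) < 1 / real p"
    using assms p_ge_2
    by (subst unity_radius_1_power[symmetric]) (auto intro!: power_strict_mono)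
  then have "d * d ^ (p - 1) < d * (1 / real p)"
    using assms(2) by (rule mult_strict_left_mono)
  then show ?thesis
    using p_gt_0 by (simp flip: power_Suc)
qed

text \<open>In this range y^p strictly dominates p y, where y = x - 1.\<close>

lemma absv_1_minus_power_p_large:
  assumes x: "absv (1 - x :: 'a) < 1" and large: "unity_radius p 1 < absv (1 - x)"
  shows "absv (1 - x ^ p) = absv (1 - x) ^ p"
proof -
  define y where "y = x - 1"
  have y: "absv y = absv (1 - x)"
    by (simp add: y_def absv_minus_commute)
  have "x \<noteq> 1"
    using large unity_radius_nonneg[OF p_ge_2, of 1] by auto
  have small: "absv (1 - x) / real p < absv (y ^ p)"
    using unity_radius_1_less_imp[OF large] by (simp add: absv_power y)
  have "absv (x ^ p - 1 - y ^ p) \<le> absv (1 - x) / real p"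
    using absv_add_le[of "x ^ p - 1 - y ^ p - of_nat p * y" "of_nat p * y"]
      absv_power_p_expansion[OF x \<open>x \<noteq> 1\<close>] y by (simp add: absv_mult absv_p y_def)
  then have "absv (y ^ p + (x ^ p - 1 - y ^ p)) = absv (y ^ p)"
    using small by (intro absv_add_eq_left) simp
  then show ?thesis
    by (simp add: absv_minus_commute absv_power y)
qed

text \<open>In this range p y strictly dominates y^p, unless y = 0.\<close>

lemma absv_1_minus_power_p_small:
  assumes small: "absv (1 - x :: 'a) < unity_radius p 1"
  shows "absv (1 - x ^ p) = absv (1 - x) / real p"
proof (cases "x = 1")
  case False
  define y where "y = x - 1"
  have y: "absv y = absv (1 - x)"
    by (simp add: y_def absv_minus_commute)
  have x: "absv (1 - x) < 1"
    using small unity_radius_less_1[OF p_ge_2, of 1] by simp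
  have "absv (y ^ p) < absv (of_nat p * y)"
    using less_unity_radius_1_imp[OF small] False by (simp add: absv_power absv_mult absv_p y)
  moreover have "absv (x ^ p - 1 - y ^ p - of_nat p * y) < absv (of_nat p * y)"
    using absv_power_p_expansion[OF x False] y by (simp add: absv_mult absv_p y_def)
  ultimately have "absv (of_nat p * y + ((x ^ p - 1 - y ^ p - of_nat p * y) + y ^ p))
      = absv (of_nat p * y)"
    by (intro absv_add_eq_left order_le_less_trans[OF absv_add_le]) simp
  then show ?thesis
    by (simp add: absv_minus_commute absv_mult absv_p y)
qed simp

lemma absv_1_minus_power_p_power_small:
  assumes "absv (1 - x :: 'a) < unity_radius p 1"
  shows "absv (1 - x ^ p ^ i) = absv (1 - x) / real p ^ i"
proof (induction i)
  case (Suc i)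
  have "absv (1 - x) / real p ^ i \<le> absv (1 - x)"
    using p_ge_2 by (intro divide_left_mono[of 1 _ "absv (1 - x)", simplified]) auto
  then have "absv (1 - x ^ p ^ i) < unity_radius p 1"
    using assms Suc by simp
  from absv_1_minus_power_p_small[OF this] show ?case
    using Suc by (simp add: power_mult[symmetric] mult.commute)
qed simp

lemma unity_radius_iterated_power: "unity_radius p (Suc (i + j)) ^ p ^ i = unity_radius p (Suc j)"
proof (induction i)
  case (Suc i)
  have "unity_radius p (Suc (Suc i + j)) ^ p ^ Suc i = (unity_radius p (Suc (Suc (i + j))) ^ p) ^ p ^ i"
    by (simp add: power_mult)
  then show ?case
    using Suc unity_radius_power[OF p_ge_2, of "Suc (i + j)"] by simp
qed simp

lemma absv_1_minus_power_p_power_large: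
  assumes x: "absv (1 - x :: 'a) < 1" and t: "unity_radius p t \<le> absv (1 - x)" and i: "i < t"
  shows "absv (1 - x ^ p ^ i) = absv (1 - x) ^ p ^ i"
  using i
proof (induction i)
  case (Suc i)
  define j where "j = t - Suc i"
  have j: "t = Suc (i + j)" "0 < j"
    using Suc.prems by (auto simp: j_def)
  have IH: "absv (1 - x ^ p ^ i) = absv (1 - x) ^ p ^ i"
    using Suc by simp
  \<comment> \<open>After \<open>i\<close> steps the lower bound on the distance has dropped from
    the radius of index \<open>t\<close> to that of index t - i \<ge> 2, so y^p still
    dominates.\<close>
  have "unity_radius p (Suc 0) < unity_radius p (Suc j)"
    using j strict_mono_less[OF unity_radius_strict_mono[OF p_ge_2]] by simp
  also have "\<dots> = unity_radius p t ^ p ^ i"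
    using unity_radius_iterated_power[of i j] j by simp
  also have "\<dots> \<le> absv (1 - x ^ p ^ i)"
    unfolding IH using t unity_radius_nonneg[OF p_ge_2] by (intro power_mono) auto
  finally have "unity_radius p 1 < absv (1 - x ^ p ^ i)"
    by simp
  moreover have "absv (1 - x ^ p ^ i) < 1"
    unfolding IH using x p_gt_0 by (intro power_Suc_less_one[THEN order_less_le_trans] power_less_one_iff[THEN iffD2]) auto
  ultimately have "absv (1 - (x ^ p ^ i) ^ p) = absv (1 - x ^ p ^ i) ^ p"
    by (intro absv_1_minus_power_p_large)
  then show ?case
    by (simp add: IH power_mult[symmetric] mult.commute)
qed simp

text \<open>Before the last step the distance may equal \<open>unity_radius p 1\<close>. Then y^p
  and p y have the same size and may cancel, so only an upper bound survives.\<close>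

lemma absv_1_minus_power_p_power_le:
  assumes x: "absv (1 - x :: 'a) < 1" and t: "unity_radius p t \<le> absv (1 - x)"
  shows "absv (1 - x ^ p ^ t) \<le> absv (1 - x) ^ p ^ t"
proof (cases t)
  case (Suc i)
  have IH: "absv (1 - x ^ p ^ i) = absv (1 - x) ^ p ^ i"
    using absv_1_minus_power_p_power_large[OF x t] Suc by simp
  have "unity_radius p 1 = unity_radius p t ^ p ^ i"
    using unity_radius_iterated_power[of i 0] Suc by simp
  also have "\<dots> \<le> absv (1 - x ^ p ^ i)"
    unfolding IH using t unity_radius_nonneg[OF p_ge_2] by (intro power_mono) auto
  finally have ge: "unity_radius p 1 \<le> absv (1 - x ^ p ^ i)" .
  have "absv (1 - x ^ p ^ i) / real p \<le> absv (1 - x ^ p ^ i) ^ p"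
  proof (cases "unity_radius p 1 = absv (1 - x ^ p ^ i)")
    case True
    have "unity_radius p 1 * unity_radius p 1 ^ (p - 1) = unity_radius p 1 / real p"
      using unity_radius_1_power[OF p_ge_2] by simp
    then show ?thesis
      unfolding True[symmetric] using p_gt_0 by (simp flip: power_Suc)
  next
    case False
    then show ?thesis
      using ge unity_radius_1_less_imp[of "absv (1 - x ^ p ^ i)"] by simp
  qed
  moreover have "absv (1 - x ^ p ^ i) < 1"
    unfolding IH using x p_gt_0 by (intro power_less_one_iff[THEN iffD2]) auto
  ultimately have "absv (1 - (x ^ p ^ i) ^ p) \<le> absv (1 - x ^ p ^ i) ^ p"
    using absv_1_minus_power_p_le[of "x ^ p ^ i"] by simp
  then show ?thesis
    by (simp add: Suc IH power_mult[symmetric] mult.commute)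
qed simp

lemma inverse_p_le_unity_radius:
  assumes "1 \<le> j"
  shows "1 / real p \<le> unity_radius p j"
proof -
  have "1 / real p = unity_radius p 1 ^ (p - 1)"
    using unity_radius_1_power[OF p_ge_2] by simp
  also have "\<dots> \<le> unity_radius p 1 ^ 1"
    using p_ge_2 unity_radius_pos[OF p_ge_2, of 1] unity_radius_less_1[OF p_ge_2, of 1]
    by (intro power_decreasing) auto
  also have "\<dots> \<le> unity_radius p j"
    using assms strict_mono_less_eq[OF unity_radius_strict_mono[OF p_ge_2]] by simp
  finally show ?thesis .
qed

text \<open>Consecutive radii are related by \<open>p\<close>-th powers, which handles y^p; and |p
  y| < 1 / p is below every radius of positive index.\<close>

lemma absv_1_minus_power_p_less_unity_radius:
  assumes "absv (1 - x :: 'a) < unity_radius p (Suc (Suc j))"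
  shows "absv (1 - x ^ p) < unity_radius p (Suc j)"
proof -
  have x: "absv (1 - x) < 1"
    using assms unity_radius_less_1[OF p_ge_2, of "Suc (Suc j)"] by simp
  have "absv (1 - x) ^ p < unity_radius p (Suc (Suc j)) ^ p"
    using assms p_gt_0 by (intro power_strict_mono) auto
  also have "\<dots> = unity_radius p (Suc j)"
    using unity_radius_power[OF p_ge_2, of "Suc j"] by simp
  finally have "absv (1 - x) ^ p < unity_radius p (Suc j)" .
  moreover have "absv (1 - x) / real p < 1 / real p"
    using x p_gt_0 by (intro divide_strict_right_mono) auto
  ultimately show ?thesis
    using absv_1_minus_power_p_le[OF x] inverse_p_le_unity_radius[of "Suc j"] by simp
qed

lemma absv_1_minus_power_p_power_less_unity_radius:
  "absv (1 - x :: 'a) < unity_radius p (Suc s) \<Longrightarrow> absv (1 - x ^ p ^ s) < unity_radius p 1"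
proof (induction s arbitrary: x)
  case (Suc s)
  then have "absv (1 - (x ^ p) ^ p ^ s) < unity_radius p 1"
    by (intro Suc.IH absv_1_minus_power_p_less_unity_radius)
  then show ?case
    by (simp add: power_mult)
qed simp

lemma absv_root_of_unity:
  assumes "x ^ n = (1 :: 'a)" "0 < n"
  shows "absv x = 1"
proof -
  have "absv x ^ n = 1 ^ n"
    using assms absv_power[of x n] by simp
  then show ?thesis
    using assms(2) by (subst (asm) power_eq_iff_eq_base) auto
qed


end


section \<open>Roots of unity\<close>

context padic_complex_field
begin

section \<open>Existence of roots of unity of \<open>p\<close>-power order\<close>

lemma in_Qp_algebraicI:
  assumes "(q :: 'a poly) \<noteq> 0" "\<And>i. coeff q i \<in> range of_rat" "poly q x = 0"
  shows "x \<in> Qp_algebraic"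
  unfolding Qp_algebraic_def Qp_part_def using assms closure_subset by blast

lemma of_rat_in_Qp_algebraic: "(of_rat c :: 'a) \<in> Qp_algebraic"
proof (rule in_Qp_algebraicI)
  show "coeff [:- of_rat c, 1 :: 'a:] i \<in> range of_rat" for i
    by (auto simp: coeff_pCons split: nat.split
        intro: range_eqI[of _ _ "- c"] range_eqI[of _ _ 1] range_eqI[of _ _ 0]
        simp: of_rat_minus)
qed auto

lemma in_Qp_algebraic_simps: "(0 :: 'a) \<in> Qp_algebraic" "(1 :: 'a) \<in> Qp_algebraic"
  using of_rat_in_Qp_algebraic[of 0] of_rat_in_Qp_algebraic[of 1] by auto

lemma root_of_unity_in_Qp_algebraic:
  assumes "x ^ n = (1 :: 'a)" "0 < n"
  shows "x \<in> Qp_algebraic"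
proof (rule in_Qp_algebraicI)
  show "monom 1 n - (1 :: 'a poly) \<noteq> 0"
    using assms(2) by (auto simp: poly_eq_iff intro!: exI[of _ n])
  show "coeff (monom 1 n - (1 :: 'a poly)) i \<in> range of_rat" for i
    using assms(2)
    by (auto simp: coeff_monom intro: range_eqI[of _ _ "- 1"] range_eqI[of _ _ 1] range_eqI[of _ _ 0]
        simp: of_rat_minus)
  show "poly (monom 1 n - 1) x = 0"
    using assms(1) by (simp add: poly_monom)
qed

lemma Qp_algebraic_root_ex:
  assumes "degree (q :: 'a poly) > 0" "\<And>i. coeff q i \<in> Qp_algebraic"
  shows "\<exists>x. poly q x = 0"
  using assms Cp unfolding padic_complex_numbers_def by blast

text \<open>The assumption concerns - y because that is the constant coefficient of X^n - y.\<close>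

lemma nth_root_ex:
  assumes "- y \<in> (Qp_algebraic :: 'a set)" "0 < n"
  shows "\<exists>x. x ^ n = y"
proof -
  have coeffs: "coeff (monom 1 n + [:- y:]) i \<in> Qp_algebraic" for i
    using assms in_Qp_algebraic_simps by (cases i) (auto simp: coeff_monom)
  have "coeff (monom 1 n + [:- y:]) n \<noteq> 0"
    using assms(2) by (simp add: coeff_pCons split: nat.split)
  then have "0 < degree (monom 1 n + [:- y:])"
    using assms(2) le_degree by (metis gr0I not_less)
  from Qp_algebraic_root_ex[OF this coeffs] show ?thesis
    by (auto simp: poly_monom)
qed

text \<open>A root of 1 + X + ... + X^(p-1) has order \<open>p\<close>: at 1 the value is p, nonzero
  in characteristic 0. Taking \<open>p\<close>-th roots repeatedly raises the order.\<close>

lemma primitive_root_ex: "\<exists>z :: 'a. z ^ p ^ Suc k = 1 \<and> z ^ p ^ k \<noteq> 1"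
proof (induction k)
  case 0
  define q :: "'a poly" where "q = (\<Sum>i<p. monom 1 i)"
  have coeff: "coeff q i = (if i < p then 1 else 0)" for i
    by (simp add: q_def coeff_sum coeff_monom)
  have "coeff q (p - 1) \<noteq> 0"
    using p_gt_0 by (simp add: coeff)
  then have "p - 1 \<le> degree q"
    by (rule le_degree)
  then have "degree q > 0"
    using p_ge_2 by simp
  moreover have "coeff q i \<in> Qp_algebraic" for i
    by (simp add: coeff in_Qp_algebraic_simps)
  ultimately obtain z where "poly q z = 0"
    using Qp_algebraic_root_ex by blast
  then have sum: "(\<Sum>i<p. z ^ i) = 0"
    by (simp add: q_def poly_sum poly_monom)
  then have "z ^ p = 1"
    using one_diff_power_eq[of z p] by simp
  moreover have "z \<noteq> 1"
    using sum p_gt_0 by auto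
  ultimately show ?case by auto
next
  case (Suc k)
  then obtain z :: 'a where z: "z ^ p ^ Suc k = 1" "z ^ p ^ k \<noteq> 1"
    by blast
  \<comment> \<open>Doubling the exponent removes the sign, so \<open>- z\<close> is a root of unity
    too.\<close>
  have "(- z) ^ (2 * p ^ Suc k) = (z ^ p ^ Suc k) ^ 2"
    by (simp add: power_mult[symmetric] mult_ac)
  then have "- z \<in> Qp_algebraic"
    using z(1) p_gt_0 by (intro root_of_unity_in_Qp_algebraic[of _ "2 * p ^ Suc k"]) auto
  then obtain w where w: "w ^ p = z"
    using nth_root_ex p_gt_0 by blast
  have "w ^ p ^ Suc n = z ^ p ^ n" for n
    by (simp add: power_mult w)
  then show ?case
    using z by metis
qed

text \<open>If two powers agreed, Bezout would give z^g = 1 for the gcd \<open>g\<close> of the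
  difference of exponents and p^(k+1). This \<open>g\<close> is a smaller power of \<open>p\<close>,
  so it divides p^k, against the choice of z.\<close>

lemma inj_on_powers_primitive_root:
  assumes z: "z ^ p ^ Suc k = (1 :: 'a)" "z ^ p ^ k \<noteq> 1"
  shows "inj_on (\<lambda>i. z ^ i) {..<p ^ Suc k}"
proof (rule linorder_inj_onI)
  fix i j assume ij: "i < j" "i \<in> {..<p ^ Suc k}" "j \<in> {..<p ^ Suc k}"
  show "z ^ i \<noteq> z ^ j"
  proof
    assume "z ^ i = z ^ j"
    moreover have "z \<noteq> 0"
      using z(1) p_gt_0 by (auto simp: power_0_left)
    ultimately have one: "z ^ (j - i) = 1"
      using ij by (simp add: power_diff)
    define g where "g = gcd (j - i) (p ^ Suc k)"
    have "j - i \<noteq> 0"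
      using ij by simp
    then obtain x y where xy: "(j - i) * x = p ^ Suc k * y + g"
      using bezout_nat unfolding g_def by blast
    have "z ^ ((j - i) * x) = 1" "z ^ (p ^ Suc k * y) = 1"
      by (simp_all only: power_mult one z power_one)
    then have "z ^ g = 1"
      by (simp add: xy power_add)
    have "g dvd p ^ Suc k"
      by (simp add: g_def)
    then obtain e where e: "e \<le> Suc k" "g = p ^ e"
      using divides_primepow_nat[OF prime_p] by blast
    have "g \<le> j - i"
      using ij by (auto simp: g_def intro: dvd_imp_le)
    then have "e \<noteq> Suc k"
      using ij e by auto
    then have "p ^ k = g * p ^ (k - e)"
      using e by (simp flip: power_add)
    then show False
      using z(2) \<open>z ^ g = 1\<close> by (simp add: power_mult)
  qed
qed (rule linear)

text \<open>As polynomials both sides are monic of degree \<open>card A\<close> and agree on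
  \<open>A\<close>, so their difference has more zeros than its degree permits.\<close>

lemma power_minus_1_eq_prod:
  fixes A :: "'a set"
  assumes "\<And>a. a \<in> A \<Longrightarrow> a ^ card A = 1" "finite A" "0 < card A"
  shows "x ^ card A - 1 = (\<Prod>a\<in>A. x - a)"
proof -
  let ?P = "monom 1 (card A) - (1 :: 'a poly)" and ?Q = "\<Prod>a\<in>A. [:- a, 1:]"
  have deg: "degree ?Q = card A"
    by (simp add: degree_prod_eq_sum_degree)
  have "?P = ?Q"
  proof (rule poly_eqI_degree_lead_coeff)
    have "lead_coeff ?Q = 1"
      by (simp add: lead_coeff_prod)
    then show "coeff ?P (card A) = coeff ?Q (card A)"
      using assms(3) by (simp add: deg)
    show "degree ?P \<le> card A"
      by (rule degree_diff_le) (auto simp: degree_monom_le)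
    show "poly ?P z = poly ?Q z" if "z \<in> A" for z
      using assms that by (auto simp: poly_monom poly_prod)
  qed (use deg in auto)
  then have "poly ?P x = poly ?Q x" by simp
  then show ?thesis
    by (simp add: poly_monom poly_prod)
qed

lemma p_power_roots_factorization:
  obtains A :: "'a set" where "finite A" "card A = p ^ k" "\<And>a. a \<in> A \<Longrightarrow> a ^ p ^ k = 1"
    "\<And>x. x ^ p ^ k - 1 = (\<Prod>a\<in>A. x - a)"
proof -
  have "\<exists>A :: 'a set. finite A \<and> card A = p ^ k \<and> (\<forall>a\<in>A. a ^ p ^ k = 1)"
  proof (cases k)
    case 0
    then show ?thesis by (intro exI[of _ "{1}"]) auto
  next
    case (Suc i)
    obtain z :: 'a where z: "z ^ p ^ Suc i = 1" "z ^ p ^ i \<noteq> 1"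
      using primitive_root_ex by blast
    have "(z ^ j) ^ p ^ k = 1" for j
      using z(1) by (metis Suc mult.commute power_mult power_one)
    then show ?thesis
      using card_image[OF inj_on_powers_primitive_root[OF z]]
      by (intro exI[of _ "(\<lambda>i. z ^ i) ` {..<p ^ k}"]) (auto simp: Suc)
  qed
  then obtain A :: "'a set" where A: "finite A" "card A = p ^ k" "\<And>a. a \<in> A \<Longrightarrow> a ^ p ^ k = 1"
    by blast
  then show thesis
    using that[of A] power_minus_1_eq_prod[of A] p_gt_0 by simp
qed

text \<open>After \<open>s\<close> steps the power of \<gamma> is within
  \<open>unity_radius p 1\<close> of 1, where each further step multiplies the distance by exactly 1
  / p. From there 1 is reached only by starting at 1.\<close>

lemma p_power_unity_root_close_imp:
  assumes "\<gamma> \<in> p_power_unity_roots p" "absv (1 - \<gamma> :: 'a) < unity_radius p (Suc s)"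
  shows "\<gamma> ^ p ^ s = 1"
proof -
  obtain k where k: "\<gamma> ^ p ^ k = 1"
    using assms(1) by (auto simp: p_power_unity_roots_def)
  have small: "absv (1 - \<gamma> ^ p ^ s) < unity_radius p 1"
    using absv_1_minus_power_p_power_less_unity_radius[OF assms(2)] .
  have "(\<gamma> ^ p ^ s) ^ p ^ k = (\<gamma> ^ p ^ k) ^ p ^ s"
    by (simp add: mult.commute flip: power_mult)
  then have "absv (1 - \<gamma> ^ p ^ s) / real p ^ k = 0"
    using absv_1_minus_power_p_power_small[OF small, of k] k by simp
  then show ?thesis
    using p_gt_0 by simp
qed

lemma p_power_unity_roots_mult:
  assumes "\<gamma> \<in> p_power_unity_roots p" "\<delta> \<in> p_power_unity_roots p"
  shows "\<gamma> * \<delta> \<in> (p_power_unity_roots p :: 'a set)"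
proof -
  obtain k l where "\<gamma> ^ p ^ k = 1" "\<delta> ^ p ^ l = 1"
    using assms by (auto simp: p_power_unity_roots_def)
  then have "(\<gamma> * \<delta>) ^ p ^ (k + l) = 1"
    by (simp add: power_add power_mult_distrib) (metis mult.commute mult_1 power_mult power_one)
  then show ?thesis
    by (auto simp: p_power_unity_roots_def)
qed

text \<open>The set of roots of unity of \<open>p\<close>-power order is infinite, but only finitely many of them can compete with 1.\<close>

lemma arg_min_p_power_unity_roots:
  assumes "absv (1 - l :: 'a) < 1"
  defines "\<gamma>0 \<equiv> arg_min_on (\<lambda>\<gamma>. absv (\<gamma> - l)) (p_power_unity_roots p)"
  shows "\<gamma>0 \<in> p_power_unity_roots p"
    and "\<gamma> \<in> p_power_unity_roots p \<Longrightarrow> absv (\<gamma>0 - l) \<le> absv (\<gamma> - l)"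
proof -
  let ?f = "\<lambda>\<gamma>. absv (\<gamma> - l)" and ?G = "p_power_unity_roots p :: 'a set"
  define s where "s = radius_index p (absv (1 - l))"
  have s: "absv (1 - l) < unity_radius p (Suc s)"
    unfolding s_def using assms(1) by (intro radius_index_bounds p_ge_2) auto
  define T where "T = {\<gamma> :: 'a. \<gamma> ^ p ^ s = 1}"
  have "monom 1 (p ^ s) - (1 :: 'a poly) \<noteq> 0"
    using p_gt_0 by (auto simp: poly_eq_iff intro!: exI[of _ "p ^ s"])
  then have "finite T"
    using poly_roots_finite[of "monom 1 (p ^ s) - (1 :: 'a poly)"] by (simp add: T_def poly_monom)
  have "1 \<in> T" "T \<subseteq> ?G"
    by (auto simp: T_def p_power_unity_roots_def)
  obtain g where g: "g \<in> T" "\<And>\<gamma>. \<gamma> \<in> T \<Longrightarrow> ?f g \<le> ?f \<gamma>"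
    using arg_min_if_finite[OF \<open>finite T\<close>, of ?f] \<open>1 \<in> T\<close> by (metis empty_iff not_less)
  have "?f g \<le> ?f \<gamma>" if "\<gamma> \<in> ?G" for \<gamma>
  proof (cases "\<gamma> \<in> T")
    case False
    \<comment> \<open>Roots outside \<open>T\<close> are farther from 1 than \<open>l\<close> is, so
      their distance to \<open>l\<close> equals their distance to 1 and exceeds |1 - l|, the value
      at the competitor 1.\<close>
    then have "unity_radius p (Suc s) \<le> absv (1 - \<gamma>)"
      using p_power_unity_root_close_imp[OF that, of s] by (force simp: T_def)
    then have "absv (1 - l) < absv (\<gamma> - 1)"
      using s by (simp add: absv_minus_commute)
    then have "?f \<gamma> = absv (\<gamma> - 1)"
      using absv_add_eq_left[of "1 - l" "\<gamma> - 1"] by simp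
    then show ?thesis
      using g(2)[OF \<open>1 \<in> T\<close>] \<open>absv (1 - l) < absv (\<gamma> - 1)\<close> by simp
  qed (rule g)
  then have "is_arg_min ?f (\<lambda>\<gamma>. \<gamma> \<in> ?G) g"
    using g \<open>T \<subseteq> ?G\<close> by (auto simp: is_arg_min_def not_less)
  then have "is_arg_min ?f (\<lambda>\<gamma>. \<gamma> \<in> ?G) \<gamma>0"
    unfolding \<gamma>0_def arg_min_on_def arg_min_def by (rule someI)
  then show "\<gamma>0 \<in> ?G" "\<gamma> \<in> ?G \<Longrightarrow> absv (\<gamma>0 - l) \<le> absv (\<gamma> - l)"
    by (auto simp: is_arg_min_def not_less)
qed

text \<open>Before index \<open>s\<close> only y^p dominates. From \<open>s\<close> on,
  \<open>l\<close> and \<open>\<mu> = l / \<gamma>0\<close> have the same p^i-th powers, and \<mu>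
  lies at distance |\<gamma>0 - l| from 1. Minimality of this distance settles the possible tie at
  step \<open>t\<close>; after it each step divides by \<open>p\<close>.\<close>

lemma absv_1_minus_power_p_power:
  assumes l: "absv (1 - l :: 'a) < 1"
  defines "\<gamma>0 \<equiv> arg_min_on (\<lambda>\<gamma>. absv (\<gamma> - l)) (p_power_unity_roots p)"
  defines "s \<equiv> radius_index p (absv (1 - l))" and "t \<equiv> radius_index p (absv (\<gamma>0 - l))"
  shows "t \<le> s"
    and "i < s \<Longrightarrow> absv (1 - l ^ p ^ i) = absv (1 - l) ^ p ^ i"
    and "s \<le> i \<Longrightarrow> absv (1 - l ^ p ^ i) = absv (\<gamma>0 - l) ^ p ^ t / real p ^ (i - t)"
proof -
  define \<beta> where "\<beta> = absv (\<gamma>0 - l)"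
  have mem: "\<gamma>0 \<in> p_power_unity_roots p"
    and min: "\<And>\<gamma>. \<gamma> \<in> p_power_unity_roots p \<Longrightarrow> \<beta> \<le> absv (\<gamma> - l)"
    unfolding \<beta>_def \<gamma>0_def using arg_min_p_power_unity_roots[OF l] by auto
  have \<beta>: "0 \<le> \<beta>" "\<beta> \<le> absv (1 - l)"
    using min[of 1] by (auto simp: \<beta>_def p_power_unity_roots_def)
  have s: "unity_radius p s \<le> absv (1 - l)" "absv (1 - l) < unity_radius p (Suc s)"
    unfolding s_def using l radius_index_bounds[OF p_ge_2, of "absv (1 - l)"] by auto
  have t: "unity_radius p t \<le> \<beta>" "\<beta> < unity_radius p (Suc t)"
    unfolding t_def \<beta>_def[symmetric] using l \<beta> radius_index_bounds[OF p_ge_2, of \<beta>] by auto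
  have "unity_radius p t < unity_radius p (Suc s)"
    using s t \<beta> by simp
  then show "t \<le> s"
    using strict_mono_less[OF unity_radius_strict_mono[OF p_ge_2]] by simp
  show "absv (1 - l ^ p ^ i) = absv (1 - l) ^ p ^ i" if "i < s"
    by (rule absv_1_minus_power_p_power_large[OF l s(1) that])
  assume i: "s \<le> i"
  obtain k where "\<gamma>0 ^ p ^ k = 1"
    using mem by (auto simp: p_power_unity_roots_def)
  then have \<gamma>0: "absv \<gamma>0 = 1"
    using absv_root_of_unity p_gt_0 by auto
  have "absv (1 - \<gamma>0) \<le> max (absv (1 - l)) (absv (l - \<gamma>0))"
    using absv_add_le[of "1 - l" "l - \<gamma>0"] by simp
  then have "absv (1 - \<gamma>0) < unity_radius p (Suc s)"
    using s \<beta> by (simp add: \<beta>_def absv_minus_commute)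
  then have "\<gamma>0 ^ p ^ s = 1"
    by (rule p_power_unity_root_close_imp[OF mem])
  moreover have "p ^ i = p ^ s * p ^ (i - s)"
    using i by (simp flip: power_add)
  ultimately have \<gamma>0_pow: "\<gamma>0 ^ p ^ i = 1"
    by (simp add: power_mult)
  define \<mu> where "\<mu> = l / \<gamma>0"
  have "\<gamma>0 \<noteq> 0"
    using \<gamma>0 by auto
  have \<mu>_diff: "absv (\<mu> - \<gamma>) = absv (\<gamma>0 * \<gamma> - l)" for \<gamma>
  proof -
    have "\<mu> - \<gamma> = (l - \<gamma>0 * \<gamma>) / \<gamma>0"
      using \<open>\<gamma>0 \<noteq> 0\<close> by (simp add: \<mu>_def field_simps)
    then show ?thesis
      using \<gamma>0 by (simp add: absv_divide absv_minus_commute)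
  qed
  then have \<mu>: "absv (1 - \<mu>) = \<beta>"
    using \<mu>_diff[of 1] by (simp add: \<beta>_def absv_minus_commute)
  obtain A :: "'a set" where A: "finite A" "card A = p ^ t" "\<And>a. a \<in> A \<Longrightarrow> a ^ p ^ t = 1"
    "\<And>x. x ^ p ^ t - 1 = (\<Prod>a\<in>A. x - a)"
    using p_power_roots_factorization[of t] by blast
  \<comment> \<open>A factor \<mu> - a has absolute value |\<gamma>0 a - l|, and \<gamma>0 a is
    again a root of unity of \<open>p\<close>-power order, so minimality bounds each factor below by
    \<beta>.\<close>
  have "\<beta> ^ p ^ t = (\<Prod>a\<in>A. \<beta>)"
    using A by simp
  also have "\<dots> \<le> (\<Prod>a\<in>A. absv (\<mu> - a))"
  proof (intro prod_mono conjI)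
    fix a assume "a \<in> A"
    then have "a \<in> p_power_unity_roots p"
      using A(3) by (auto simp: p_power_unity_roots_def)
    then show "\<beta> \<le> absv (\<mu> - a)"
      unfolding \<mu>_diff by (intro min p_power_unity_roots_mult mem)
  qed (rule \<beta>)
  also have "\<dots> = absv (1 - \<mu> ^ p ^ t)"
    by (subst (2) absv_minus_commute) (simp add: A(4) absv_prod)
  finally have "\<beta> ^ p ^ t \<le> absv (1 - \<mu> ^ p ^ t)" .
  moreover have "absv (1 - \<mu> ^ p ^ t) \<le> \<beta> ^ p ^ t"
    using absv_1_minus_power_p_power_le[of \<mu> t] t l \<beta> by (simp add: \<mu>)
  ultimately have eq: "absv (1 - \<mu> ^ p ^ t) = \<beta> ^ p ^ t"
    by simp
  have "absv (1 - \<mu> ^ p ^ t) < unity_radius p 1"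
    using absv_1_minus_power_p_power_less_unity_radius[of \<mu> t] t by (simp add: \<mu>)
  from absv_1_minus_power_p_power_small[OF this, of "i - t"]
  have "absv (1 - (\<mu> ^ p ^ t) ^ p ^ (i - t)) = \<beta> ^ p ^ t / real p ^ (i - t)"
    by (simp add: eq)
  also have "(\<mu> ^ p ^ t) ^ p ^ (i - t) = \<mu> ^ p ^ i"
    using i \<open>t \<le> s\<close> by (simp flip: power_mult power_add)
  also have "\<mu> ^ p ^ i = l ^ p ^ i"
    by (simp add: \<mu>_def power_divide \<gamma>0_pow)
  finally show "absv (1 - l ^ p ^ i) = absv (\<gamma>0 - l) ^ p ^ t / real p ^ (i - t)"
    by (simp add: \<beta>_def)
qed

end


section \<open>Averages of functions of the valuation\<close>

lemma sum_if_dvd: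
  fixes c :: real
  assumes "0 < (m :: nat)"
  shows "(\<Sum>j=1..n. if m dvd j then c else 0) = c * real (n div m)"
proof (induction n)
  case (Suc n)
  then show ?case
    by (auto simp: div_Suc algebra_simps dvd_eq_mod_eq_0)
qed simp

text \<open>As in Legendre's formula, exchanging the sums counts \<open>d i\<close> once for each j
  divisible by p^i; the bound on \<open>n\<close> rules out indices above \<open>K\<close>.\<close>

lemma sum_of_valuation:
  fixes d :: "nat \<Rightarrow> real"
  assumes p: "prime p" and n: "n < p ^ Suc K"
  shows "(\<Sum>j=1..n. \<Sum>i\<le>multiplicity p j. d i) = (\<Sum>i\<le>K. d i * real (n div p ^ i))"
proof -
  have "(\<Sum>i\<le>multiplicity p j. d i) = (\<Sum>i\<le>K. if p ^ i dvd j then d i else 0)"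
    if j: "j \<in> {1..n}" for j
  proof -
    have dvd_iff: "p ^ i dvd j \<longleftrightarrow> i \<le> multiplicity p j" for i
      using j p by (intro power_dvd_iff_le_multiplicity) auto
    have "p ^ multiplicity p j \<le> j"
      using j by (intro dvd_imp_le multiplicity_dvd) auto
    then have "p ^ multiplicity p j < p ^ Suc K"
      using j n by simp
    then have "multiplicity p j < Suc K"
      using prime_gt_1_nat[OF p] by (rule power_less_imp_less_exp[rotated])
    then have "{..K} \<inter> {i. p ^ i dvd j} = {..multiplicity p j}"
      by (auto simp: dvd_iff)
    then show ?thesis
      by (simp add: sum.If_cases)
  qed
  then have "(\<Sum>j=1..n. \<Sum>i\<le>multiplicity p j. d i)
      = (\<Sum>j=1..n. \<Sum>i\<le>K. if p ^ i dvd j then d i else 0)"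
    by (rule sum.cong[OF refl])
  also have "\<dots> = (\<Sum>i\<le>K. d i * real (n div p ^ i))"
    using sum_if_dvd[of "p ^ _" _ n] prime_gt_0_nat[OF p] by (subst sum.swap) simp
  finally show ?thesis .
qed

text \<open>As \<open>d\<close> is nonnegative, dropping the floors in n div p^i can only increase
  the sum.\<close>

lemma sum_of_valuation_le:
  fixes d :: "nat \<Rightarrow> real"
  assumes p: "prime p" and d: "\<And>i. 0 \<le> d i"
    and L: "\<And>K. K \<ge> K0 \<Longrightarrow> (\<Sum>i\<le>K. d i / real p ^ i) \<le> L"
  shows "(\<Sum>j=1..n. \<Sum>i\<le>multiplicity p j. d i) \<le> real n * L"
proof -
  define K where "K = max n K0"
  have "n < 2 ^ n"
    by (rule less_exp)
  also have "(2 :: nat) ^ n \<le> p ^ n"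
    using prime_ge_2_nat[OF p] by (rule power_mono) simp
  also have "p ^ n \<le> p ^ Suc K"
    using prime_gt_0_nat[OF p] by (intro power_increasing) (auto simp: K_def)
  finally have "n < p ^ Suc K" .
  then have "(\<Sum>j=1..n. \<Sum>i\<le>multiplicity p j. d i) = (\<Sum>i\<le>K. d i * real (n div p ^ i))"
    by (rule sum_of_valuation[OF p])
  also have "\<dots> \<le> (\<Sum>i\<le>K. d i * (real n / real p ^ i))"
    using d of_nat_div_le_of_nat[of n "p ^ _"] by (intro sum_mono mult_left_mono) auto
  also have "\<dots> = real n * (\<Sum>i\<le>K. d i / real p ^ i)"
    by (simp add: sum_distrib_left mult_ac)
  also have "\<dots> \<le> real n * L"
    by (intro mult_left_mono L) (auto simp: K_def)
  finally show ?thesis .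
qed

text \<open>At p^N the quotients are exact, so nothing is lost to floors.\<close>

lemma sum_of_valuation_prime_power:
  fixes d :: "nat \<Rightarrow> real"
  assumes p: "prime p"
  shows "(\<Sum>j=1..p ^ N. \<Sum>i\<le>multiplicity p j. d i) = real p ^ N * (\<Sum>i\<le>N. d i / real p ^ i)"
proof -
  have "(\<Sum>j=1..p ^ N. \<Sum>i\<le>multiplicity p j. d i) = (\<Sum>i\<le>N. d i * real (p ^ N div p ^ i))"
    using prime_gt_1_nat[OF p] by (intro sum_of_valuation p) simp
  also have "\<dots> = (\<Sum>i\<le>N. real p ^ N * (d i / real p ^ i))"
  proof (rule sum.cong[OF refl])
    fix i assume "i \<in> {..N}"
    then have "p ^ i dvd p ^ N"
      by (simp add: le_imp_power_dvd)
    then show "d i * real (p ^ N div p ^ i) = real p ^ N * (d i / real p ^ i)"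
      by (simp add: real_of_nat_div)
  qed
  finally show ?thesis
    by (simp add: sum_distrib_left)
qed

text \<open>Used with u i = ln |1 - \<lambda>^(p^i)|, q = p, A = ln |1 - \<lambda>|, B = ln
  |\<gamma>0 - \<lambda>|, P = ln p. The summands are constant for 0 < i < s and geometric for i >
  s, leaving the tail P / (q^K (q - 1)); the summand at s joins the regimes.\<close>

lemma weighted_increment_sum:
  fixes u :: "nat \<Rightarrow> real" and q A B P :: real
  assumes q: "q > 1" and ts: "t \<le> s"
    and large: "\<And>i. i < s \<Longrightarrow> u i = A * q ^ i"
    and small: "\<And>i. s \<le> i \<Longrightarrow> u i = B * q ^ t - (real i - real t) * P"
    and K: "s \<le> K"
  shows "(\<Sum>i\<le>K. (if i = 0 then - u 0 else u (i - 1) - u i) / q ^ i)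
    = - (real s * (1 - 1 / q) * A + q ^ t / q ^ s * B
         - P * ((real s - real t) / q ^ s + 1 / (q ^ s * (q - 1)))) - P / (q ^ K * (q - 1))"
proof -
  define e where "e = (\<lambda>i. (if i = 0 then - u 0 else u (i - 1) - u i) / q ^ i)"
  have below: "(\<Sum>i\<le>k. e i) = - A - real k * (1 - 1 / q) * A" if "k < s" for k
    using that
  proof (induction k)
    case 0
    then show ?case by (simp add: e_def large)
  next
    case (Suc k)
    have "e (Suc k) = - (1 - 1 / q) * A"
      using Suc.prems q by (simp add: e_def large field_simps)
    then show ?case
      using Suc by (simp add: algebra_simps)
  qed
  \<comment> \<open>For s = 0 the summand at s is \<open>- u 0\<close> instead of a difference, and
    t = 0 as well.\<close>
  have at_s: "(\<Sum>i\<le>s. e i) = - (real s * (1 - 1 / q) * A + q ^ t / q ^ s * B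
         - P * ((real s - real t) / q ^ s + 1 / (q ^ s * (q - 1)))) - P / (q ^ s * (q - 1))"
  proof (cases s)
    case 0
    then show ?thesis
      using ts small[of 0] by (simp add: e_def)
  next
    case (Suc k)
    have "(\<Sum>i\<le>s. e i) = (\<Sum>i\<le>k. e i) + e s"
      using Suc by simp
    also have "(\<Sum>i\<le>k. e i) = - A - real k * (1 - 1 / q) * A"
      using Suc by (intro below) simp
    also have "e s = A / q - q ^ t / q ^ s * B + (real s - real t) * P / q ^ s"
    proof -
      have "e s = (A * q ^ k - (B * q ^ t - (real s - real t) * P)) / q ^ s"
        using Suc small[of s] large[of k] by (simp add: e_def)
      moreover have "A * q ^ k / q ^ s = A / q"
        using Suc q by simp
      ultimately show ?thesis
        by (simp add: diff_divide_distrib mult.commute)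
    qed
    finally show ?thesis
      using Suc by (simp add: algebra_simps)
  qed
  have "(\<Sum>i\<le>K. e i) = - (real s * (1 - 1 / q) * A + q ^ t / q ^ s * B
         - P * ((real s - real t) / q ^ s + 1 / (q ^ s * (q - 1)))) - P / (q ^ K * (q - 1))"
    using K
  proof (induction K rule: dec_induct)
    case base
    show ?case by (rule at_s)
  next
    case (step k)
    have "e (Suc k) = P / q ^ Suc k"
      using step small[of k] small[of "Suc k"] by (simp add: e_def algebra_simps)
    moreover have "P / q ^ Suc k - P / (q ^ k * (q - 1)) = - P / (q ^ Suc k * (q - 1))"
      using q by (simp add: field_simps)
    ultimately show ?case
      using step by simp
  qed
  then show ?thesis
    by (simp add: e_def)
qed


section \<open>The conjugacy as a formal power series\<close>

text \<open>In degree \<open>n\<close> the summand of index \<open>n\<close> of the composition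
  carries \<lambda>^n, where \<lambda> is the linear coefficient of \<open>f\<close>. Moving it to
  the other side leaves a triangular system.\<close>

lemma conjugacy_equation_iff:
  fixes f H :: "'a::field fps"
  assumes "fps_nth f 0 = 0"
  shows "H oo f = fps_const (fps_nth f 1) * H \<longleftrightarrow>
    (\<forall>n. fps_nth H n * (fps_nth f 1 - fps_nth f 1 ^ n) = (\<Sum>i<n. fps_nth H i * fps_nth (f ^ i) n))"
proof -
  have "fps_nth (H oo f) n
      = (\<Sum>i<n. fps_nth H i * fps_nth (f ^ i) n) + fps_nth H n * fps_nth f 1 ^ n" for n
    using startsby_zero_power_nth_same[OF assms, of n]
    by (simp add: fps_compose_nth atLeast0AtMost flip: lessThan_Suc_atMost)
  then show ?thesis
    by (auto simp: fps_eq_iff algebra_simps)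
qed

text \<open>The solution of the triangular system. In degree 1 the denominator vanishes, and the
  value 1 is the normalisation.\<close>

fun conjugacy_coeff :: "'a::field fps \<Rightarrow> nat \<Rightarrow> 'a" where
  "conjugacy_coeff f n = (if n = 0 then 0 else if n = 1 then 1 else
     (\<Sum>i<n. conjugacy_coeff f i * fps_nth (f ^ i) n) / (fps_nth f 1 - fps_nth f 1 ^ n))"

declare conjugacy_coeff.simps [simp del]

text \<open>For n \<ge> 2 the factor \<lambda> - \<lambda>^n = \<lambda> (1 - \<lambda>^(n-1)) is
  nonzero, so the earlier coefficients determine the next one. This existence and uniqueness justify
  the definite description.\<close>

lemma conjugacy_series_properties:
  fixes f :: "'a::field fps"
  assumes f0: "fps_nth f 0 = 0" and f1: "fps_nth f 1 \<noteq> 0"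
    and nonres: "\<And>n. n \<ge> 1 \<Longrightarrow> fps_nth f 1 ^ n \<noteq> 1"
  shows "fps_nth (conjugacy_series f) 0 = 0" "fps_nth (conjugacy_series f) 1 = 1"
    "conjugacy_series f oo f = fps_const (fps_nth f 1) * conjugacy_series f"
proof -
  define Q where "Q = (\<lambda>H. fps_nth H 0 = 0 \<and> fps_nth H 1 = 1 \<and>
      H oo f = fps_const (fps_nth f 1) * H)"
  have denom: "fps_nth f 1 - fps_nth f 1 ^ n \<noteq> 0" if "n \<ge> 2" for n
  proof -
    define k where "k = n - 1"
    have k: "n = Suc k" "k \<ge> 1"
      using that by (auto simp: k_def)
    have "fps_nth f 1 - fps_nth f 1 ^ n = fps_nth f 1 * (1 - fps_nth f 1 ^ k)"
      by (simp add: k algebra_simps)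
    then show ?thesis
      using f1 nonres[OF k(2)] by simp
  qed
  define H where "H = Abs_fps (conjugacy_coeff f)"
  have H: "fps_nth H n = conjugacy_coeff f n" for n
    by (simp add: H_def)
  have "Q H"
    unfolding Q_def conjugacy_equation_iff[OF f0]
  proof (intro conjI allI)
    show "fps_nth H 0 = 0" "fps_nth H 1 = 1"
      by (simp_all add: H conjugacy_coeff.simps)
    fix n
    consider "n = 0" | "n = Suc 0" | "n \<ge> 2" by linarith
    then show "fps_nth H n * (fps_nth f 1 - fps_nth f 1 ^ n)
        = (\<Sum>i<n. fps_nth H i * fps_nth (f ^ i) n)"
    proof cases
      case 3
      then show ?thesis
        using denom[OF 3] conjugacy_coeff.simps[of f n] by (simp add: H)
    qed (simp_all add: H conjugacy_coeff.simps)
  qed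
  moreover have "G = H" if "Q G" for G
  proof (rule fps_ext)
    fix n
    show "fps_nth G n = fps_nth H n"
    proof (induction n rule: less_induct)
      case (less n)
      consider "n = 0" | "n = Suc 0" | "n \<ge> 2" by linarith
      then show ?case
      proof cases
        case 3
        have "fps_nth G n * (fps_nth f 1 - fps_nth f 1 ^ n)
            = (\<Sum>i<n. fps_nth G i * fps_nth (f ^ i) n)"
          using that unfolding Q_def conjugacy_equation_iff[OF f0] by blast
        also have "\<dots> = (\<Sum>i<n. fps_nth H i * fps_nth (f ^ i) n)"
          using less by (intro sum.cong) auto
        also have "\<dots> = fps_nth H n * (fps_nth f 1 - fps_nth f 1 ^ n)"
          using \<open>Q H\<close> unfolding Q_def conjugacy_equation_iff[OF f0] by simp
        finally show ?thesis
          using denom[OF 3] by simp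
      qed (use that \<open>Q H\<close> in \<open>auto simp: Q_def\<close>)
    qed
  qed
  ultimately have "Q (THE H. Q H)"
    by (rule theI)
  then have "Q (conjugacy_series f)"
    by (simp add: conjugacy_series_def Q_def multiplier_def)
  then show "fps_nth (conjugacy_series f) 0 = 0" "fps_nth (conjugacy_series f) 1 = 1"
    "conjugacy_series f oo f = fps_const (fps_nth f 1) * conjugacy_series f"
    by (auto simp: Q_def)
qed

text \<open>Write (l x + x^2)^i as x^i (l + x)^i and expand. For n > 2 i the binomial coefficient is
  0.\<close>

lemma fps_nth_P_quadratic_power:
  "fps_nth (P_quadratic l ^ i) n
    = (if n < i then 0 else of_nat (i choose (n - i)) * l ^ (i - (n - i)) :: 'a::comm_ring_1)"
proof -
  have coeff: "coeff ([:l, 1:] ^ i) k = of_nat (i choose k) * l ^ (i - k)" for k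
  proof (cases "k \<le> i")
    case True
    then show ?thesis by (simp add: coeff_linear_poly_power)
  next
    case False
    have "degree ([:l, 1:] ^ i) \<le> degree [:l, 1:] * i"
      by (rule degree_power_le)
    also have "\<dots> \<le> i"
      by simp
    finally show ?thesis
      using False by (simp add: coeff_eq_0 binomial_eq_0)
  qed
  have "[:0, l, 1:] = monom 1 1 * [:l, 1:]"
    by (simp add: monom_Suc monom_0)
  then have "[:0, l, 1:] ^ i = monom 1 i * [:l, 1:] ^ i"
    by (simp only: power_mult_distrib monom_power) simp
  then show ?thesis
    by (simp add: P_quadratic_def coeff_monom_mult coeff flip: fps_of_poly_power)
qed

lemma fps_nth_P_quadratic:
  "fps_nth (P_quadratic l) 0 = 0" "fps_nth (P_quadratic l) (Suc 0) = (l :: 'a::comm_ring_1)"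
  "fps_nth (P_quadratic l) n = (if n = 1 then l else if n = 2 then 1 else 0)"
  by (auto simp: P_quadratic_def coeff_pCons split: nat.split)


section \<open>Density of the value group\<close>

context padic_complex_field
begin

lemma absv_power_int: "absv (x powi n :: 'a) = absv x powi n"
  by (simp add: power_int_def absv_power absv_inverse)

text \<open>Roots of powers of \<open>p\<close> realise every rational power of \<open>p\<close> as
  an absolute value, and these are dense in the positive reals.\<close>

lemma absv_between_ex:
  assumes "0 < a" "a < b"
  shows "\<exists>x :: 'a. a < absv x \<and> absv x < b"
proof -
  have lnp: "0 < ln (real p)"
    using p_ge_2 by simp
  have "ln a / ln (real p) < ln b / ln (real p)"
    using assms lnp by (intro divide_strict_right_mono) auto
  then obtain q where q: "q \<in> \<rat>" "ln a / ln (real p) < q" "q < ln b / ln (real p)"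
    using Rats_dense_in_real by blast
  then obtain m n where mn: "q = of_int m / of_int n" "n > 0"
    by (auto elim!: Rats_cases')
  \<comment> \<open>Two signs: \<open>nth_root_ex\<close> needs the negative of the radicand to be
    algebraic, and p^(-m) has absolute value p^m.\<close>
  define c :: rat where "c = - (of_nat p powi (- m))"
  have "of_rat c = - ((of_nat p :: 'a) powi (- m))"
    by (simp add: c_def power_int_def of_rat_minus of_rat_power of_rat_inverse)
  then have "- ((of_nat p :: 'a) powi (- m)) \<in> Qp_algebraic"
    using of_rat_in_Qp_algebraic[of c] by simp
  then obtain x :: 'a where x: "x ^ nat n = of_nat p powi (- m)"
    using nth_root_ex[of _ "nat n"] mn(2) by auto
  have "absv x ^ nat n = (1 / real p) powi (- m)"
    using absv_power[of x "nat n"] by (simp add: x absv_power_int absv_p)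
  also have "\<dots> = real p powi m"
    by (simp add: power_int_minus power_int_divide_distrib)
  finally have pow: "absv x ^ nat n = real p powi m" .
  have "x \<noteq> 0"
  proof
    assume "x = 0"
    then have "real p powi m = 0"
      using pow mn(2) by (simp add: power_0_left)
    then show False
      using p_gt_0 by simp
  qed
  then have pos: "0 < absv x" by simp
  have "of_int n * ln (absv x) = ln (absv x ^ nat n)"
    using pos mn(2) by (simp add: ln_realpow)
  also have "\<dots> = of_int m * ln (real p)"
    unfolding pow using p_gt_0 by (simp add: powr_real_of_int'[symmetric] ln_powr)
  finally have "ln (absv x) = of_int m * ln (real p) / of_int n"
    using mn(2) by (simp add: eq_divide_eq mult.commute)
  then have "ln (absv x) = q * ln (real p)"
    by (simp add: mn(1))
  then have "ln a < ln (absv x)" "ln (absv x) < ln b"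
    using q(2,3) lnp by (auto simp: field_simps)
  then show ?thesis
    using pos assms by auto
qed

lemma Sup_absv_ball:
  assumes "0 < r"
  shows "(SUP x\<in>ball (0 :: 'a) r. absv x) = r"
proof (rule cSup_eq_non_empty)
  show "absv ` ball (0 :: 'a) r \<noteq> {}"
    using assms by auto
  show "y \<le> r" if "y \<in> absv ` ball (0 :: 'a) r" for y
    using that by (auto simp: dist_absv)
  show "r \<le> y" if y: "\<And>z. z \<in> absv ` ball (0 :: 'a) r \<Longrightarrow> z \<le> y" for y
  proof (rule ccontr)
    assume "\<not> r \<le> y"
    moreover have "0 \<le> y"
      using y[of 0] assms by (force simp: dist_absv)
    ultimately have "0 < (y + r) / 2" "(y + r) / 2 < r"
      using assms by auto
    then obtain x :: 'a where x: "(y + r) / 2 < absv x" "absv x < r"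
      using absv_between_ex by blast
    then have "absv x \<le> y"
      by (intro y) (auto simp: dist_absv)
    then show False
      using x \<open>\<not> r \<le> y\<close> by simp
  qed
qed

end


section \<open>Quadratic polynomials\<close>

locale quadratic_multiplier = padic_complex_field p ty
  for p :: nat and ty :: "'a::{field_char_0, complete_space} itself" +
  fixes l :: 'a
  assumes p_ge_3: "p \<ge> 3"
    and not_root_of_unity: "\<And>n. n \<ge> 1 \<Longrightarrow> l ^ n \<noteq> 1"
    and absv_bounds: "1 / real p < absv (1 - l)" "absv (1 - l) < 1"
begin

lemma absv_l: "absv l = 1"
  by (rule absv_eq_1_if_close[OF absv_bounds(2)])

abbreviation H where "H \<equiv> conjugacy_series (P_quadratic l)"

lemma H_0: "fps_nth H 0 = 0" and H_1: "fps_nth H 1 = 1"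
  and H_compose: "H oo P_quadratic l = fps_const l * H"
proof -
  have "l \<noteq> 0"
    using absv_l by auto
  then show "fps_nth H 0 = 0" "fps_nth H 1 = 1" "H oo P_quadratic l = fps_const l * H"
    using conjugacy_series_properties[of "P_quadratic l"] not_root_of_unity
    by (simp_all add: fps_nth_P_quadratic(1,2))
qed

section \<open>Exact growth of the coefficients of the conjugacy\<close>

definition a :: "nat \<Rightarrow> real" where "a n = absv (1 - l ^ n)"

lemma a_pos: "n \<ge> 1 \<Longrightarrow> 0 < a n"
  using not_root_of_unity[of n] by (simp add: a_def)

lemma a_le: "a n \<le> a 1"
  using absv_1_minus_power_le[OF absv_bounds(2)] by (simp add: a_def)

lemma a_1: "1 / real p < a 1" "a 1 < 1"
  using absv_bounds by (auto simp: a_def)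

lemma a_eq_valuation:
  assumes "n \<ge> 1"
  shows "a n = a (p ^ multiplicity p n)"
proof -
  obtain m where m: "n = p ^ multiplicity p n * m" "\<not> p dvd m"
    using multiplicity_decompose'[of n p] assms p_ge_2 by auto
  have "absv (1 - l ^ p ^ multiplicity p n) < 1"
    using a_le[of "p ^ multiplicity p n"] a_1 by (simp add: a_def)
  from absv_1_minus_power_coprime[OF this m(2)] show ?thesis
    using m(1) by (simp add: a_def flip: power_mult)
qed

lemma a_coprime: "\<not> p dvd n \<Longrightarrow> a n = a 1"
  using absv_1_minus_power_coprime[OF absv_bounds(2)] by (simp add: a_def)

text \<open>Both competing bounds |1 - l|^p and |1 - l| / p are at most |1 - l|^2, the second
  because |1 - l| > 1 / p. This makes \<open>c\<close> exceed 1 at multiples of \<open>p\<close> and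
  \<open>d 1\<close> nonnegative.\<close>

lemma a_p_le: "a p \<le> a 1 ^ 2"
proof -
  have pos: "0 < a 1"
    by (rule a_pos) simp
  have "a 1 ^ p \<le> a 1 ^ 2"
    using p_ge_2 a_1 pos by (intro power_decreasing) auto
  moreover have "a 1 / real p \<le> a 1 ^ 2"
    using mult_left_mono[of "1 / real p" "a 1" "a 1"] a_1 pos by (simp add: power2_eq_square)
  moreover have "a p \<le> max (a 1 ^ p) (a 1 / real p)"
    using absv_1_minus_power_p_le[OF absv_bounds(2)] by (simp add: a_def)
  ultimately show ?thesis by simp
qed

lemma a_prime_power_Suc_le: "a (p ^ Suc i) \<le> a (p ^ i)"
proof -
  have "absv (1 - l ^ p ^ i) < 1"
    using a_le[of "p ^ i"] a_1 by (simp add: a_def)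
  from absv_1_minus_power_le[OF this, of p] show ?thesis
    by (simp add: a_def mult.commute flip: power_mult)
qed

definition c :: "nat \<Rightarrow> real" where
  "c n = (if p dvd n then a 1 / a n else 1 / a 1)"

lemma c_gt_1:
  assumes "n \<ge> 1"
  shows "c n > 1"
proof (cases "p dvd n")
  case True
  then obtain m where m: "n = p * m" by blast
  have "absv (1 - l ^ p) < 1"
    using a_le[of p] a_1 by (simp add: a_def)
  then have "a n \<le> a p"
    using absv_1_minus_power_le[of "l ^ p" m] by (simp add: a_def m power_mult)
  also have "\<dots> \<le> a 1 ^ 2"
    by (rule a_p_le)
  also have "\<dots> < a 1"
    using a_1 a_pos[of 1] by (simp add: power2_eq_square)
  finally show ?thesis
    using a_pos[OF assms] True by (simp add: c_def)
qed (use a_1 a_pos[of 1] in \<open>simp add: c_def\<close>)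

text \<open>
  In the recursion for the coefficient of index \<open>n + 1\<close> the term of index \<open>n\<close> dominates, unless
  \<open>p\<close> divides \<open>n\<close>: then its factor \<open>n\<close> has absolute value at most \<open>1 / p < a 1\<close>, and the term of
  index \<open>n - 1\<close>, whose binomial coefficient is a unit, takes over.
\<close>

lemma absv_H_Suc:
  assumes "n \<ge> 1"
  shows "absv (fps_nth H (Suc n)) = c n * absv (fps_nth H n)"
  using assms
proof (induction n rule: less_induct)
  case (less n)
  define B where "B = (\<lambda>i. absv (fps_nth H i))"
  have B: "B 0 = 0" "B 1 = 1"
    using H_0 H_1 by (simp_all add: B_def)
  \<comment> \<open>By the induction hypothesis and \<open>c > 1\<close> the absolute values
    increase strictly up to index \<open>n\<close>, so a late term with a unit coefficient dominates
    all earlier ones.\<close>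
  have step: "B j < B (Suc j)" if "j < n" for j
    using that
  proof (induction j)
    case (Suc j)
    have "0 \<le> B j"
      by (simp add: B_def)
    then have "0 < B (Suc j)"
      using Suc by simp
    moreover have "B (Suc (Suc j)) = c (Suc j) * B (Suc j)"
      using less.IH[of "Suc j"] Suc.prems by (simp add: B_def)
    ultimately show ?case
      using c_gt_1[of "Suc j"] by simp
  qed (use B in simp)
  have mono: "B i < B j" if "i < j" "j \<le> n" for i j
    using that
  proof (induction j)
    case (Suc j)
    then show ?case
      using step[of j] by (cases "i = j") auto
  qed simp
  have Bpos: "0 < B j" if "1 \<le> j" "j \<le> n" for j
    using mono[of 0 j] that by (simp add: B)
  define T where "T = (\<lambda>i. fps_nth H i * fps_nth (P_quadratic l ^ i) (Suc n))"
  have T_le: "absv (T i) \<le> B i" for i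
    using absv_of_nat_le_1[of "i choose (Suc n - i)"]
    by (simp add: T_def B_def fps_nth_P_quadratic_power absv_mult absv_power absv_l mult_left_le)
  have rest: "absv (\<Sum>i<k. T i) < B k" if "1 \<le> k" "k \<le> n" for k
  proof -
    have "absv (\<Sum>i<k. T i) \<le> B (k - 1)"
    proof (rule absv_sum_le)
      fix i assume "i \<in> {..<k}"
      then have "i = k - 1 \<or> i < k - 1"
        by auto
      then have "B i \<le> B (k - 1)"
        using that mono[of i "k - 1"] by (cases "i = k - 1") (auto simp: less_imp_le)
      then show "absv (T i) \<le> B (k - 1)"
        using T_le[of i] by simp
    qed (simp add: B_def)
    also have "\<dots> < B k"
      using mono[of "k - 1" k] that by simp
    finally show ?thesis .
  qed
  have recursion: "fps_nth H (Suc n) * (l - l ^ Suc n) = (\<Sum>i<Suc n. T i)"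
    using conjugacy_equation_iff[of "P_quadratic l" H] H_compose
    by (simp add: fps_nth_P_quadratic(1,2) T_def del: sum.lessThan_Suc power_Suc)
  have "l - l ^ Suc n = l * (1 - l ^ n)"
    by (simp add: algebra_simps)
  then have "absv (fps_nth H (Suc n)) * a n = absv (fps_nth H (Suc n) * (l - l ^ Suc n))"
    by (simp add: absv_mult absv_l a_def)
  also note recursion
  finally have "absv (fps_nth H (Suc n)) * a n = absv (\<Sum>i<Suc n. T i)" .
  then have eq: "absv (fps_nth H (Suc n)) = absv (\<Sum>i<Suc n. T i) / a n"
    using a_pos[OF less.prems] by (simp add: field_simps)
  have T_n: "absv (T n) = B n * absv (of_nat n :: 'a)"
    by (simp add: T_def B_def fps_nth_P_quadratic_power absv_mult absv_power absv_l)
  show ?case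
  proof (cases "p dvd n")
    case False
    then have "absv (\<Sum>i<n. T i) < absv (T n)"
      using rest[of n] less.prems by (simp add: T_n absv_of_nat_coprime)
    then have "absv (\<Sum>i<Suc n. T i) = B n"
      using absv_add_eq_left[of "\<Sum>i<n. T i" "T n"] False
      by (simp add: add.commute T_n absv_of_nat_coprime)
    then show ?thesis
      using False by (simp add: eq c_def a_coprime B_def)
  next
    case True
    \<comment> \<open>As \<open>p \<ge> 3\<close>, both n - 1 and n - 2 are positive and prime to
      \<open>p\<close>; hence so is (n - 1 choose 2), the binomial coefficient of the term of index
      n - 1.\<close>
    then have "n \<ge> 3"
      using less.prems p_ge_3 by (auto dest: dvd_imp_le)
    then obtain k where k: "n = Suc (Suc k)" "1 \<le> k"
      by (cases n; cases "n - 1") auto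
    have "\<not> p dvd Suc k"
      using True p_ge_2 dvd_diff_nat[of p n "Suc k"] by (auto simp: k)
    \<comment> \<open>The passage from n - 1 to n multiplied by only 1 / \<open>a 1\<close> < p,
      whereas the factor n in the term of index n costs at least a factor p; so that term is the
      smaller one.\<close>
    then have B_n: "B (Suc k) = a 1 * B n"
      using less.IH[of "Suc k"] a_pos[of 1] by (simp add: k c_def B_def)
    have "\<not> p dvd k"
    proof
      assume "p dvd k"
      then have "p dvd 2"
        using True dvd_diff_nat[of p n k] by (simp add: k)
      then show False
        using p_ge_3 by (auto dest: dvd_imp_le)
    qed
    moreover have "2 * (Suc k choose 2) = Suc k * k"
      by (simp add: choose_two)
    ultimately have "\<not> p dvd (Suc k choose 2)"
      using \<open>\<not> p dvd Suc k\<close> prime_dvd_mult_iff[OF prime_p] by (metis dvd_mult)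
    then have T_k: "absv (T (Suc k)) = B (Suc k)"
      by (simp add: T_def B_def fps_nth_P_quadratic_power absv_mult absv_power absv_l k
          absv_of_nat_coprime numeral_2_eq_2 del: binomial_Suc_Suc)
    have "absv (T n) \<le> B n * (1 / real p)"
      unfolding T_n using True by (intro mult_left_mono absv_of_nat_dvd_le) (auto simp: B_def)
    also have "\<dots> < B n * a 1"
      using a_1 Bpos[of n] less.prems by (intro mult_strict_left_mono) auto
    finally have "absv (T n) < absv (T (Suc k))"
      by (simp add: T_k B_n mult.commute)
    moreover have "absv (\<Sum>i<Suc k. T i) < absv (T (Suc k))"
      using rest[of "Suc k"] k by (simp add: T_k)
    ultimately have "absv ((\<Sum>i<Suc k. T i) + T n) < absv (T (Suc k))"
      by (intro order_le_less_trans[OF absv_add_le]) simp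
    then have "absv (T (Suc k) + ((\<Sum>i<Suc k. T i) + T n)) = B (Suc k)"
      using absv_add_eq_left T_k by simp
    moreover have "(\<Sum>i<Suc n. T i) = T (Suc k) + ((\<Sum>i<Suc k. T i) + T n)"
      by (simp add: k add_ac)
    ultimately have "absv (\<Sum>i<Suc n. T i) = a 1 * B n"
      using B_n by (simp only:)
    then show ?thesis
      unfolding eq using True by (simp add: c_def B_def)
  qed
qed

text \<open>Increments of \<open>ln (c n)\<close> as a function of the valuation of n. The extra
  term at index 1 reflects the two cases of \<open>c\<close> and produces the factor |1 - l|^(-1/p)
  of the radius.\<close>

definition d :: "nat \<Rightarrow> real" where
  "d i = (if i = 0 then - ln (a 1) else ln (a (p ^ (i - 1))) - ln (a (p ^ i)))
     + (if i = 1 then ln (a 1) else 0)"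

lemma d_nonneg: "0 \<le> d i"
proof -
  have pos: "0 < a (p ^ k)" for k
    using p_gt_0 by (intro a_pos) (simp add: Suc_le_eq)
  consider "i = 0" | "i = 1" | k where "i = Suc k" "k \<ge> 1"
    by (cases i) (auto simp: Suc_le_eq)
  then show ?thesis
  proof cases
    case 1
    then show ?thesis
      using a_1 a_pos[of 1] by (simp add: d_def ln_le_zero_iff)
  next
    case 2
    have "ln (a p) \<le> ln (a 1 ^ 2)"
        using a_p_le pos[of 1] zero_less_power[OF a_pos[of 1], of 2]
      by (subst ln_le_cancel_iff) auto
    then show ?thesis
      using a_pos[of 1] 2 by (simp add: d_def ln_realpow)
  next
    case 3
    then show ?thesis
      using a_prime_power_Suc_le[of k] pos[of k] pos[of "Suc k"] by (simp add: d_def)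
  qed
qed

lemma sum_d: "(\<Sum>i\<le>k. d i) = (if k = 0 then 0 else ln (a 1)) - ln (a (p ^ k))"
proof (induction k)
  case 0
  then show ?case by (simp add: d_def)
next
  case (Suc k)
  then show ?case by (cases k) (simp_all add: d_def)
qed

lemma ln_c:
  assumes "n \<ge> 1"
  shows "ln (c n) = (\<Sum>i\<le>multiplicity p n. d i)"
proof -
  have "multiplicity p n = 0 \<longleftrightarrow> \<not> p dvd n"
    using assms p_ge_2 by (intro multiplicity_eq_zero_iff) auto
  then show ?thesis
    using a_pos[OF assms] a_pos[of 1] a_eq_valuation[OF assms] a_coprime[of n]
    by (auto simp: c_def sum_d ln_div)
qed

lemma ln_absv_H:
  "0 < absv (fps_nth H (Suc n)) \<and>
   ln (absv (fps_nth H (Suc n))) = (\<Sum>j=1..n. \<Sum>i\<le>multiplicity p j. d i)"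
proof (induction n)
  case 0
  then show ?case
    using H_1 by simp
next
  case (Suc n)
  then show ?case
    using absv_H_Suc[of "Suc n"] c_gt_1[of "Suc n"] ln_c[of "Suc n"] by (simp add: ln_mult)
qed

section \<open>The radius formula as a limit of averages\<close>

definition r :: real where "r = absv (1 - l) powr (- (1 / real p)) * r_tilde p l"

text \<open>The sum comes from \<open>weighted_increment_sum\<close> and the correction at index 1,
  valid once K is at least \<open>s\<close> and 1. Its exact tail is kept, though it tends to 0,
  because it decides convergence on the circle of radius \<open>r\<close>.\<close>

lemma radius:
  shows r_pos: "0 < r"
    and sum_d_eq: "\<exists>K0. \<forall>K\<ge>K0. (\<Sum>i\<le>K. d i / real p ^ i)
      = - ln r - ln (real p) / (real p ^ K * (real p - 1))"
proof -
  define \<gamma>0 where "\<gamma>0 = arg_min_on (\<lambda>\<gamma>. absv (\<gamma> - l)) (p_power_unity_roots p)"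
  define \<beta> where "\<beta> = absv (\<gamma>0 - l)"
  define s where "s = radius_index p (absv (1 - l))"
  define t where "t = radius_index p \<beta>"
  have ts: "t \<le> s"
    and large: "\<And>i. i < s \<Longrightarrow> a (p ^ i) = a 1 ^ p ^ i"
    and small: "\<And>i. s \<le> i \<Longrightarrow> a (p ^ i) = \<beta> ^ p ^ t / real p ^ (i - t)"
    using absv_1_minus_power_p_power[OF absv_bounds(2)]
    by (auto simp: s_def t_def \<beta>_def \<gamma>0_def a_def)
  have "\<gamma>0 \<in> p_power_unity_roots p"
    unfolding \<gamma>0_def by (rule arg_min_p_power_unity_roots[OF absv_bounds(2)])
  then have "\<gamma>0 \<noteq> l"
    using not_root_of_unity p_gt_0 by (auto simp: p_power_unity_roots_def Suc_le_eq)
  then have \<beta>: "0 < \<beta>"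
    by (simp add: \<beta>_def)
  have a1: "absv (1 - l) = a 1" "0 < a 1"
    using a_pos[of 1] by (auto simp: a_def)
  have q: "real p > 1"
    using p_ge_2 by simp
  \<comment> \<open>Here m = 1 in the definition of \<open>r_tilde\<close>, since |1 - l| <
    1.\<close>
  have "(LEAST n. n \<ge> 1 \<and> absv (1 - l ^ n) < 1) = 1"
    using absv_bounds(2) by (intro Least_equality) auto
  then have r_tilde: "r_tilde p l = unity_radius p (Suc s)
      * real p powr (- ((real s - real t) / real p ^ s))
      * a 1 powr (real s * ((real p - 1) / real p))
      * \<beta> powr (1 / real p powr (real s - real t))"
    using unity_radius_pos[OF p_ge_2, of "Suc s"]
    by (simp add: r_tilde_def Let_def s_def t_def \<beta>_def \<gamma>0_def a_def)
  have R_pos: "0 < unity_radius p (Suc s)"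
    using unity_radius_pos[OF p_ge_2] by simp
  then have rt_pos: "0 < r_tilde p l"
    using a1 \<beta> q by (simp add: r_tilde)
  then show "0 < r"
    using a1 by (simp add: r_def)
  have ln_R: "ln (unity_radius p (Suc s)) = - ln (real p) / (real p ^ s * (real p - 1))"
    using q by (simp add: unity_radius_def ln_powr)
  have "ln (r_tilde p l) = - (ln (real p) / (real p ^ s * (real p - 1)))
      - (real s - real t) / real p ^ s * ln (real p) + real s * ((real p - 1) / real p) * ln (a 1)
      + 1 / real p powr (real s - real t) * ln \<beta>"
    using R_pos a1 \<beta> q by (simp add: r_tilde ln_mult ln_powr ln_R)
  moreover have "1 / real p powr (real s - real t) = real p ^ t / real p ^ s"
    using q by (simp add: powr_diff powr_realpow)
  moreover have "(real p - 1) / real p = 1 - 1 / real p"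
    using q by (simp add: diff_divide_distrib)
  moreover have "ln (real p) * ((real s - real t) / real p ^ s + 1 / (real p ^ s * (real p - 1)))
      = (real s - real t) / real p ^ s * ln (real p) + ln (real p) / (real p ^ s * (real p - 1))"
    by (simp add: distrib_left mult.commute)
  ultimately have ln_rt: "ln (r_tilde p l) = real s * (1 - 1 / real p) * ln (a 1)
      + real p ^ t / real p ^ s * ln \<beta>
      - ln (real p) * ((real s - real t) / real p ^ s + 1 / (real p ^ s * (real p - 1)))"
    by simp
  have ln_r: "ln r = ln (r_tilde p l) - ln (a 1) / real p"
    using a1 rt_pos by (simp add: r_def ln_mult ln_powr)
  have "(\<Sum>i\<le>K. d i / real p ^ i) = - ln r - ln (real p) / (real p ^ K * (real p - 1))"
    if K: "K \<ge> max s 1" for K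
  proof -
    define e where "e = (\<lambda>i. (if i = 0 then - ln (a (p ^ 0)) else ln (a (p ^ (i - 1))) - ln (a (p ^ i)))
        / real p ^ i)"
    have "(\<Sum>i\<le>K. e i) = - (real s * (1 - 1 / real p) * ln (a 1)
      + real p ^ t / real p ^ s * ln \<beta>
      - ln (real p) * ((real s - real t) / real p ^ s + 1 / (real p ^ s * (real p - 1))))
      - ln (real p) / (real p ^ K * (real p - 1))"
      unfolding e_def
    proof (rule weighted_increment_sum[OF q ts])
      show "ln (a (p ^ i)) = ln (a 1) * real p ^ i" if "i < s" for i
        using large[OF that] a1 by (simp add: ln_realpow)
      show "ln (a (p ^ i)) = ln \<beta> * real p ^ t - (real i - real t) * ln (real p)" if "s \<le> i" for i
        using small[OF that] \<beta> q ts that by (simp add: ln_div ln_realpow of_nat_diff)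
    qed (use K in simp)
    then have "(\<Sum>i\<le>K. e i) = - ln (r_tilde p l) - ln (real p) / (real p ^ K * (real p - 1))"
      by (simp add: ln_rt)
    moreover have "d i / real p ^ i = e i + (if i = 1 then ln (a 1) / real p else 0)" for i
      by (auto simp: d_def e_def add_divide_distrib)
    then have "(\<Sum>i\<le>K. d i / real p ^ i) = (\<Sum>i\<le>K. e i) + ln (a 1) / real p"
      using K by (simp add: sum.distrib)
    ultimately show ?thesis
      by (simp add: ln_r)
  qed
  then show "\<exists>K0. \<forall>K\<ge>K0. (\<Sum>i\<le>K. d i / real p ^ i)
      = - ln r - ln (real p) / (real p ^ K * (real p - 1))"
    by blast
qed

lemma absv_H_le: "absv (fps_nth H (Suc n)) * r ^ n \<le> 1"
proof -
  obtain K0 where K0: "\<And>K. K \<ge> K0 \<Longrightarrow> (\<Sum>i\<le>K. d i / real p ^ i)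
      = - ln r - ln (real p) / (real p ^ K * (real p - 1))"
    using sum_d_eq by blast
  have "(\<Sum>j=1..n. \<Sum>i\<le>multiplicity p j. d i) \<le> real n * (- ln r)"
  proof (rule sum_of_valuation_le[OF prime_p d_nonneg])
    show "(\<Sum>i\<le>K. d i / real p ^ i) \<le> - ln r" if "K \<ge> K0" for K
      using p_ge_2 by (simp add: K0[OF that])
  qed
  then have "ln (absv (fps_nth H (Suc n)) * r ^ n) \<le> 0"
    using ln_absv_H[of n] r_pos by (simp add: ln_mult ln_realpow)
  then show ?thesis
    using ln_absv_H[of n] r_pos by (simp add: ln_le_zero_iff)
qed

text \<open>The quotients are exact at p^N, and p^N times the tail of the limit is ln p / (p - 1),
  independent of \<open>N\<close>. So these products do not tend to 0.\<close>

lemma absv_H_prime_power: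
  "\<exists>N0. \<forall>N\<ge>N0. absv (fps_nth H (Suc (p ^ N))) * r ^ p ^ N = unity_radius p 1"
proof -
  obtain K0 where K0: "\<And>K. K \<ge> K0 \<Longrightarrow> (\<Sum>i\<le>K. d i / real p ^ i)
      = - ln r - ln (real p) / (real p ^ K * (real p - 1))"
    using sum_d_eq by blast
  have "absv (fps_nth H (Suc (p ^ N))) * r ^ p ^ N = unity_radius p 1" if "N \<ge> K0" for N
  proof -
    have "ln (absv (fps_nth H (Suc (p ^ N))))
        = real p ^ N * (- ln r - ln (real p) / (real p ^ N * (real p - 1)))"
      using ln_absv_H[of "p ^ N"] sum_of_valuation_prime_power[OF prime_p, of d N] K0[OF that]
      by simp
    then have "ln (absv (fps_nth H (Suc (p ^ N))) * r ^ p ^ N)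
        = real p ^ N * (- ln r - ln (real p) / (real p ^ N * (real p - 1))) + real p ^ N * ln r"
      using ln_absv_H[of "p ^ N"] r_pos by (simp add: ln_mult ln_realpow)
    also have "\<dots> = - ln (real p) / (real p - 1)"
      using p_ge_2 by (simp add: field_simps)
    also have "\<dots> = ln (unity_radius p 1)"
      using p_ge_2 by (simp add: unity_radius_def ln_powr)
    finally show ?thesis
      using ln_absv_H[of "p ^ N"] r_pos unity_radius_pos[OF p_ge_2, of 1]
      by (subst (asm) ln_inj_iff) auto
  qed
  then show ?thesis by blast
qed

section \<open>Conjugacy on the open disk and maximality\<close>

lemma bounded_series_H: "bounded_series r r H"
  unfolding bounded_series_def
proof
  fix n
  show "absv (fps_nth H n) * r ^ n \<le> r"
  proof (cases n)
    case 0
    then show ?thesis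
      using H_0 r_pos by simp
  next
    case (Suc k)
    then show ?thesis
      using mult_left_mono[OF absv_H_le[of k], of r] r_pos by (simp add: mult_ac)
  qed
qed

text \<open>The coefficient of \<open>H\<close> in degree 2 has absolute value above 1, while its
  product with \<open>r\<close> is at most 1. The inequality is needed for the term x^2 of the
  polynomial, of size r^2 at radius \<open>r\<close>.\<close>

lemma r_less_1: "r < 1"
proof -
  have "absv (fps_nth H (Suc (Suc 0))) = c 1"
    using absv_H_Suc[of 1] H_1 by simp
  then have "c 1 * r \<le> 1"
    using absv_H_le[of 1] by simp
  then show ?thesis
    using mult_strict_right_mono[OF c_gt_1[of 1] r_pos] by simp
qed

lemma bounded_series_P: "bounded_series r r (P_quadratic l)"
  unfolding bounded_series_def
proof
  fix n
  have "r * r \<le> r"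
    using r_pos r_less_1 by (simp add: mult_left_le)
  then show "absv (fps_nth (P_quadratic l) n) * r ^ n \<le> r"
    using r_pos by (auto simp: fps_nth_P_quadratic(3) absv_l power2_eq_square)
qed

text \<open>\<open>H\<close>, its formal inverse and the polynomial have Gauss norm at most
  \<open>r\<close>, so the formal identities between them may be evaluated on the disk.\<close>

lemma conjugate_on_ball: "analytically_conjugate_on (P_quadratic l) (ball 0 r)"
proof -
  obtain G where G: "bounded_series r r G" "G oo H = fps_X"
    using bounded_series_compositional_inverse[OF bounded_series_H H_0 H_1 r_pos] by blast
  have "\<forall>x\<in>ball 0 r. series_converges G (series_eval H x) \<and> series_eval G (series_eval H x) = x"
  proof
    fix x :: 'a assume "x \<in> ball 0 r"
    then have x: "absv x < r"
      by (simp add: dist_absv)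
    have "absv (series_eval H x) < r"
      using absv_series_eval_le_absv[OF x bounded_series_H H_0] x by simp
    then show "series_converges G (series_eval H x) \<and> series_eval G (series_eval H x) = x"
      using series_convergesI[OF _ G(1)] series_eval_compose[OF x G(1) bounded_series_H H_0]
      by (simp add: G(2) series_eval_X[OF x])
  qed
  moreover have "series_converges (P_quadratic l) x \<and> series_eval (P_quadratic l) x \<in> ball 0 r \<and>
      series_converges H x \<and>
      series_eval H (series_eval (P_quadratic l) x) = multiplier (P_quadratic l) * series_eval H x"
    if "x \<in> ball 0 r" for x
  proof -
    have x: "absv x < r"
      using that by (simp add: dist_absv)
    have "series_eval H (series_eval (P_quadratic l) x) = series_eval (fps_const l * H) x"
      using series_eval_compose[OF x bounded_series_H bounded_series_P fps_nth_P_quadratic(1)]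
      by (simp add: H_compose)
    then show ?thesis
      using x series_convergesI[OF x bounded_series_P] series_convergesI[OF x bounded_series_H]
        absv_series_eval_le_absv[OF x bounded_series_P fps_nth_P_quadratic(1)]
      by (simp add: dist_absv multiplier_def fps_nth_P_quadratic(2)
          series_eval_const_mult[OF x bounded_series_H])
  qed
  ultimately show ?thesis
    unfolding analytically_conjugate_on_def Let_def by blast
qed

text \<open>For |x| \<ge> r the terms of index p^N + 1 stay at least r *
  \<open>unity_radius p 1\<close> for large N. This excludes the circle |x| = r too, which is why
  the disk is open.\<close>

lemma H_convergent_imp:
  assumes "series_converges H x"
  shows "absv x < r"
proof (rule ccontr)
  assume "\<not> absv x < r"
  then have x: "r \<le> absv x" by simp
  define e where "e = r * unity_radius p 1"
  have "0 < e"
    using r_pos unity_radius_pos[OF p_ge_2, of 1] by (simp add: e_def)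
  have "(\<lambda>n. absv (fps_nth H n * x ^ n)) \<longlonglongrightarrow> 0"
    using assms unfolding series_converges_def by (rule summable_imp_absv_tendsto_0)
  from order_tendstoD(2)[OF this \<open>0 < e\<close>] obtain M where
    M: "\<And>n. n \<ge> M \<Longrightarrow> absv (fps_nth H n * x ^ n) < e"
    by (auto simp: eventually_sequentially)
  obtain N0 where N0: "\<And>N. N \<ge> N0 \<Longrightarrow> absv (fps_nth H (Suc (p ^ N))) * r ^ p ^ N = unity_radius p 1"
    using absv_H_prime_power by blast
  define N where "N = max M N0"
  have "N < 2 ^ N"
    by (rule less_exp)
  also have "(2 :: nat) ^ N \<le> p ^ N"
    using p_ge_2 by (rule power_mono) simp
  finally have "M \<le> Suc (p ^ N)"
    by (simp add: N_def)
  then have "absv (fps_nth H (Suc (p ^ N)) * x ^ Suc (p ^ N)) < e"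
    by (rule M)
  moreover have "absv (fps_nth H (Suc (p ^ N))) * r ^ Suc (p ^ N)
      \<le> absv (fps_nth H (Suc (p ^ N)) * x ^ Suc (p ^ N))"
    unfolding absv_mult absv_power using x r_pos by (intro mult_left_mono power_mono) auto
  moreover have "absv (fps_nth H (Suc (p ^ N))) * r ^ Suc (p ^ N) = e"
    using N0[of N] by (simp add: N_def e_def mult_ac)
  ultimately show False by simp
qed

text \<open>Any competing disk lies in the domain of convergence of \<open>H\<close>, which is the
  open disk itself.\<close>

lemma ball_is_linearization_disk: "is_linearization_disk (P_quadratic l) (ball 0 r)"
  unfolding is_linearization_disk_def
proof (intro conjI allI impI)
  show "is_disk (ball (0 :: 'a) r)"
    using r_pos by (auto simp: is_disk_def)
  show "analytically_conjugate_on (P_quadratic l) (ball 0 r)"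
    by (rule conjugate_on_ball)
  fix D assume "is_disk D \<and> analytically_conjugate_on (P_quadratic l) D"
  then have "\<forall>x\<in>D. series_converges H x"
    by (simp add: analytically_conjugate_on_def Let_def)
  then show "D \<subseteq> ball 0 r"
    using H_convergent_imp by (auto simp: dist_absv)
qed

text \<open>Maximality makes two linearization disks contain each other, and density of the absolute
  values turns the supremum into \<open>r\<close>.\<close>

lemma linearization_radius_eq: "linearization_radius (P_quadratic l) = r"
proof -
  have "linearization_disk (P_quadratic l) = ball 0 r"
    unfolding linearization_disk_def
  proof (rule the_equality)
    show "D = ball 0 r" if "is_linearization_disk (P_quadratic l) D" for D
      using that ball_is_linearization_disk unfolding is_linearization_disk_def by blast
  qed (rule ball_is_linearization_disk)
  then show ?thesis
    using Sup_absv_ball[OF r_pos] by (simp add: linearization_radius_def)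
qed

end

theorem theorem1p0p2:
  fixes p :: nat and lam :: "'a::{field_char_0, complete_space}"
  assumes Cp: "padic_complex_numbers p TYPE('a)"
    and p_ge_3: "p \<ge> 3"
    and not_root_of_unity: "\<And>n. n \<ge> 1 \<Longrightarrow> lam ^ n \<noteq> 1"
    and absv_bounds: "1 / real p < absv (1 - lam)" "absv (1 - lam) < 1"
  shows "is_linearization_disk (P_quadratic lam) (ball 0 (linearization_radius (P_quadratic lam))) \<and>
         linearization_radius (P_quadratic lam) = absv (1 - lam) powr (- (1 / real p)) * r_tilde p lam"
proof -
  interpret quadratic_multiplier p "TYPE('a)" lam
    using assms by unfold_locales
  show ?thesis
    using ball_is_linearization_disk by (simp add: linearization_radius_eq r_def)
qed

end
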